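(* Let $d\geq 2$, $N\geq 1$, let $A,B\in\mathbb{C}^{N,N}$ be simultaneously diagonalizable (over $\mathbb{C}$), let every eigenvalue of $A$ have positive real part, and let $S\in\mathbb{R}^{d,d}$ be skew-symmetric ($S^T=-S$). Then the function $H:\mathbb{R}^d\times\mathbb{R}^d\times(0,\infty)\to\mathbb{C}^{N,N}$, $$H(x,\xi,t)=(4\pi tA)^{-\frac d2}\exp\left(-Bt-(4tA)^{-1}\left|e^{tS}x-\xi\right|^2\right),$$ is a heat kernel of the differential operator $$[\mathcal{L}_\infty v](x)=A\triangle v(x)+\langle Sx,\nabla v(x)\rangle-Bv(x),\qquad x\in\mathbb{R}^d.$$
   Context: Here $A\triangle v=A\sum_{i=1}^d\frac{\partial^2 v}{\partial x_i^2}$ and $\langle Sx,\nabla v(x)\rangle=\sum_{i=1}^d(Sx)_i\frac{\partial v}{\partial x_i}(x)$. A function $H:\mathbb{R}^d\times\mathbb{R}^d\times(0,\infty)\to\mathbb{C}^{N,N}$, $(x,\xi,t)\mapsto H(x,\xi,t)$, is called a heat kernel of $\mathcal{L}_\infty$ if (H1) $H\in C^{2,2,1}(\mathbb{R}^d\times\mathbb{R}^d\times(0,\infty),\mathbb{C}^{N,N})$ (twice continuously differentiable in $x$ and in $\xi$, once in $t$); (H2) $\frac{\partial}{\partial t}H(x,\xi,t)=\mathcal{L}_\infty H(x,\xi,t)$ for all $x,\xi\in\mathbb{R}^d$, $t>0$, where $\mathcal{L}_\infty$ acts on the variable $x$ (columnwise); (H3) $\lim_{t\downarrow0}H(x,\xi,t)=\delta_x(\xi)I_N$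 in the sense of distributions, i.e. for every $x\in\mathbb{R}^d$ and $\phi\in C_c^\infty(\mathbb{R}^d,\mathbb{C})$, $\lim_{t\downarrow0}\int_{\mathbb{R}^d}H(x,\xi,t)\phi(\xi)\,d\xi=\phi(x)I_N$. Matrix powers: if $A=Y\,\mathrm{diag}(\lambda_1,\dots,\lambda_N)\,Y^{-1}$ then $(4\pi tA)^{-d/2}=Y\,\mathrm{diag}\big((4\pi t\lambda_k)^{-d/2}\big)\,Y^{-1}$, with $z^{-d/2}=\exp(-\frac d2\mathrm{Log}\,z)$ and $\mathrm{Log}$ the principal logarithm. *)

theory Defs
  imports "HOL-Analysis.Analysis"
begin

text \<open>The library operations \<open>*\<close>, \<open>^\<close> and \<open>exp\<close> do not denote the matrix
  operations on type \<open>'a^'n^'n\<close> (multiplication is componentwise), hence the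
  following definitions in terms of \<open>**\<close>.\<close>

primrec matrix_pow :: "'a::semiring_1^'n^'n \<Rightarrow> nat \<Rightarrow> 'a^'n^'n" where
  "matrix_pow M 0 = mat 1"
| "matrix_pow M (Suc k) = M ** matrix_pow M k"

definition matrix_exp :: "'a::real_normed_algebra_1^'n^'n \<Rightarrow> 'a^'n^'n" where
  "matrix_exp M = (\<Sum>k. (1 / fact k) *\<^sub>R matrix_pow M k)"

definition diag_matrix :: "('n \<Rightarrow> 'a::zero) \<Rightarrow> 'a^'n^'n" where
  "diag_matrix l = (\<chi> i j. if i = j then l i else 0)"

definition simultaneously_diagonalizable :: "'a::semiring_1^'n^'n \<Rightarrow> 'a^'n^'n \<Rightarrow> bool" where
  "simultaneously_diagonalizable A B \<longleftrightarrow>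
     (\<exists>(Y :: 'a^'n^'n) a b. invertible Y \<and>
        A = Y ** diag_matrix a ** matrix_inv Y \<and>
        B = Y ** diag_matrix b ** matrix_inv Y)"

definition matrix_eigenvalue :: "'a::field^'n^'n \<Rightarrow> 'a \<Rightarrow> bool" where
  "matrix_eigenvalue A l \<longleftrightarrow> (\<exists>v. v \<noteq> 0 \<and> A *v v = l *s v)"

text \<open>Principal powers of a diagonalizable complex matrix. On complex numbers,
  \<open>z powr p = exp (p * Ln z)\<close> for \<open>z \<noteq> 0\<close>, with \<open>Ln\<close> the principal logarithm. The
  lemma \<open>matrix_powr_diag\<close> shows that the result does not depend on the diagonalization.\<close>

definition matrix_powr :: "complex^'n^'n \<Rightarrow> complex \<Rightarrow> complex^'n^'n" where
  "matrix_powr M p =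
     (THE P. \<exists>(Y :: complex^'n^'n) l. invertible Y \<and> M = Y ** diag_matrix l ** matrix_inv Y \<and>
                   P = Y ** diag_matrix (\<lambda>k. l k powr p) ** matrix_inv Y)"

lemma matrix_inv_cancel:
  fixes M :: "'a::semiring_1^'n^'n"
  assumes "invertible M"
  shows "M ** matrix_inv M = mat 1" "matrix_inv M ** M = mat 1"
proof -
  have "M ** matrix_inv M = mat 1 \<and> matrix_inv M ** M = mat 1"
    using assms unfolding invertible_def matrix_inv_def by (rule someI_ex)
  then show "M ** matrix_inv M = mat 1" "matrix_inv M ** M = mat 1" by auto
qed

lemma matrix_mult_diag_right: "(M ** diag_matrix l) $ i $ j = M $ i $ j * (l j :: complex)"
  by (simp add: matrix_matrix_mult_def diag_matrix_def if_distrib cong: if_cong)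

lemma matrix_mult_diag_left: "(diag_matrix l ** M) $ i $ j = (l i :: complex) * M $ i $ j"
  by (simp add: matrix_matrix_mult_def diag_matrix_def if_distrib if_distribR cong: if_cong)

lemma diag_conj_unique:
  fixes X Y :: "complex^'n^'n"
  assumes X: "invertible X" and Y: "invertible Y"
    and eq: "X ** diag_matrix a ** matrix_inv X = Y ** diag_matrix b ** matrix_inv Y"
  shows "X ** diag_matrix (\<lambda>k. f (a k)) ** matrix_inv X = Y ** diag_matrix (\<lambda>k. f (b k)) ** matrix_inv Y"
proof -
  define Z where "Z = matrix_inv Y ** X"
  note inv = matrix_inv_cancel[OF X] matrix_inv_cancel[OF Y]
  have "matrix_inv Y ** (X ** diag_matrix a ** matrix_inv X) ** X
      = matrix_inv Y ** (Y ** diag_matrix b ** matrix_inv Y) ** X"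
    by (simp add: eq)
  then have "Z ** diag_matrix a ** (matrix_inv X ** X) = (matrix_inv Y ** Y) ** diag_matrix b ** Z"
    by (simp add: Z_def matrix_mul_assoc)
  then have "Z ** diag_matrix a = diag_matrix b ** Z"
    by (simp add: inv)
  then have "Z $ i $ j * a j = b i * Z $ i $ j" for i j
    by (metis matrix_mult_diag_left matrix_mult_diag_right)
  then have "Z $ i $ j * f (a j) = f (b i) * Z $ i $ j" for i j
    by (metis mult.commute mult_cancel_left)
  then have Zf: "Z ** diag_matrix (\<lambda>k. f (a k)) = diag_matrix (\<lambda>k. f (b k)) ** Z"
    by (simp add: vec_eq_iff matrix_mult_diag_left matrix_mult_diag_right)
  have "X ** diag_matrix (\<lambda>k. f (a k)) ** matrix_inv X
      = (Y ** matrix_inv Y) ** X ** diag_matrix (\<lambda>k. f (a k)) ** matrix_inv X"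
    by (simp add: inv)
  also have "\<dots> = Y ** (Z ** diag_matrix (\<lambda>k. f (a k))) ** matrix_inv X"
    by (simp add: Z_def matrix_mul_assoc)
  also have "\<dots> = Y ** diag_matrix (\<lambda>k. f (b k)) ** matrix_inv Y ** (X ** matrix_inv X)"
    by (simp only: Zf) (simp add: Z_def matrix_mul_assoc)
  finally show ?thesis
    by (simp add: inv)
qed

lemma matrix_powr_diag:
  fixes Y :: "complex^'n^'n"
  assumes "invertible Y"
  shows "matrix_powr (Y ** diag_matrix l ** matrix_inv Y) p =
           Y ** diag_matrix (\<lambda>k. l k powr p) ** matrix_inv Y"
  unfolding matrix_powr_def
proof (rule the_equality)
  fix P
  assume "\<exists>(X :: complex^'n^'n) m. invertible X \<and>
    Y ** diag_matrix l ** matrix_inv Y = X ** diag_matrix m ** matrix_inv X \<and>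
    P = X ** diag_matrix (\<lambda>k. m k powr p) ** matrix_inv X"
  then show "P = Y ** diag_matrix (\<lambda>k. l k powr p) ** matrix_inv Y"
    using diag_conj_unique[OF assms, where f = "\<lambda>z. z powr p"] by metis
qed (use assms in blast)

definition has_partial :: "'a::real_vector \<Rightarrow> ('a \<Rightarrow> 'b::real_normed_vector) \<Rightarrow> 'a \<Rightarrow> bool" where
  "has_partial e f p \<longleftrightarrow> (\<lambda>s::real. f (p + s *\<^sub>R e)) differentiable (at 0)"

definition partial :: "'a::real_vector \<Rightarrow> ('a \<Rightarrow> 'b::real_normed_vector) \<Rightarrow> 'a \<Rightarrow> 'b" where
  "partial e f p = vector_derivative (\<lambda>s::real. f (p + s *\<^sub>R e)) (at 0)"

primrec C_k :: "nat \<Rightarrow> ('a::euclidean_space \<Rightarrow> 'b::real_normed_vector) \<Rightarrow> bool" where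
  "C_k 0 f \<longleftrightarrow> continuous_on UNIV f"
| "C_k (Suc k) f \<longleftrightarrow> continuous_on UNIV f \<and>
     (\<forall>e\<in>Basis. (\<forall>p. has_partial e f p) \<and> C_k k (partial e f))"

definition test_function :: "('a::euclidean_space \<Rightarrow> complex) \<Rightarrow> bool" where
  "test_function \<phi> \<longleftrightarrow> (\<forall>k. C_k k \<phi>) \<and> compact (closure {x. \<phi> x \<noteq> 0})"

text \<open>\<open>C_klm k l m f\<close>: all partial derivatives of \<open>f(x,\<xi>,t)\<close> involving, in any order, at most
  \<open>k\<close> derivatives in \<open>x\<close>, \<open>l\<close> in \<open>\<xi>\<close> and \<open>m\<close> in \<open>t\<close> (mixed ones included) exist and are jointly
  continuous on the set where \<open>t > 0\<close>.\<close>

fun C_klm :: "nat \<Rightarrow> nat \<Rightarrow> nat \<Rightarrow>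
    ((real^'d) \<times> (real^'d) \<times> real \<Rightarrow> 'b::real_normed_vector) \<Rightarrow> bool" where
  "C_klm k l m f \<longleftrightarrow>
     continuous_on (UNIV \<times> UNIV \<times> {0<..}) f \<and>
     (k > 0 \<longrightarrow> (\<forall>i. (\<forall>p \<in> UNIV \<times> UNIV \<times> {0<..}. has_partial (axis i 1, 0, 0) f p) \<and>
                    C_klm (k - 1) l m (partial (axis i 1, 0, 0) f))) \<and>
     (l > 0 \<longrightarrow> (\<forall>i. (\<forall>p \<in> UNIV \<times> UNIV \<times> {0<..}. has_partial (0, axis i 1, 0) f p) \<and>
                    C_klm k (l - 1) m (partial (0, axis i 1, 0) f))) \<and>
     (m > 0 \<longrightarrow> (\<forall>p \<in> UNIV \<times> UNIV \<times> {0<..}. has_partial (0, 0, 1) f p) \<and>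
                    C_klm k l (m - 1) (partial (0, 0, 1) f))"

declare C_klm.simps [simp del]

definition laplacian :: "(real^'d \<Rightarrow> 'b::real_normed_vector) \<Rightarrow> real^'d \<Rightarrow> 'b" where
  "laplacian v x = (\<Sum>i\<in>UNIV. partial (axis i 1) (partial (axis i 1) v) x)"

definition L_inf ::
  "complex^'n^'n \<Rightarrow> complex^'n^'n \<Rightarrow> real^'d^'d \<Rightarrow> (real^'d \<Rightarrow> complex^'n) \<Rightarrow> real^'d \<Rightarrow> complex^'n"
where
  "L_inf A B S v x =
     A *v laplacian v x + (\<Sum>i\<in>UNIV. (S *v x) $ i *\<^sub>R partial (axis i 1) v x) - B *v v x"

text \<open>The factor \<open>\<phi>(\<xi>)\<close> is written as
  multiplication by the scalar matrix \<open>mat (\<phi> \<xi>)\<close>, since there is no multiplication of a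
  complex matrix by a complex scalar in the library. The integrand is continuous with
  compact support, by the differentiability condition, so the integral is a genuine one.\<close>

definition heat_kernel ::
  "((real^'d \<Rightarrow> complex^'n) \<Rightarrow> real^'d \<Rightarrow> complex^'n) \<Rightarrow>
   (real^'d \<Rightarrow> real^'d \<Rightarrow> real \<Rightarrow> complex^'n^'n) \<Rightarrow> bool"
where
  "heat_kernel L H \<longleftrightarrow>
     C_klm 2 2 1 (\<lambda>(x, \<xi>, t). H x \<xi> t) \<and>
     (\<forall>x \<xi> t j. t > 0 \<longrightarrow>
        ((\<lambda>s. column j (H x \<xi> s)) has_vector_derivative L (\<lambda>y. column j (H y \<xi> t)) x) (at t)) \<and>
     (\<forall>x \<phi>. test_function \<phi> \<longrightarrow>
        ((\<lambda>t. LINT \<xi>|lborel. H x \<xi> t ** mat (\<phi> \<xi>)) \<longlongrightarrow> mat (\<phi> x)) (at_right 0))"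

end

theory Submission
  imports Defs "HOL-Probability.Distributions"
begin

text \<open>
  Diagonalizing \<open>A\<close> and \<open>B\<close> simultaneously splits the kernel into scalar kernels
  \<open>K(x,\<xi>,t) = (4\<pi>ta)^(-d/2) exp(-bt - |e\<^sup>t\<^sup>Sx - \<xi>|\<^sup>2/(4ta))\<close>, one per common eigenvector.
  As \<open>S\<close> is skew-symmetric, \<open>e\<^sup>t\<^sup>S\<close> is orthogonal and commutes with \<open>S\<close>. The drift term therefore
  equals the time derivative of the exponent that comes from the motion of \<open>e\<^sup>t\<^sup>Sx\<close>, while the
  Laplacian acts as for the ordinary heat kernel. For the initial condition, substitute
  \<open>\<xi> = e\<^sup>t\<^sup>Sx + \<surd>t y\<close> and use dominated convergence; the normalization is the complex Gaussian
  integral, which follows from its even moments and the binomial series.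
\<close>

section \<open>The exponential of a real matrix\<close>

text \<open>Two things shape the proof. First, the eigenvalues \<open>a\<close> are complex, and
  principal powers are not multiplicative. Products under a power are therefore split only at a
  positive real factor (\<open>t\<close>, \<open>pi\<close> or a scale \<open>c\<close>), and the
  logarithm is inverted only in the open right half-plane. The Gaussian integral meets its principal
  square root through a power series, where no branch has to be tracked. Second, regularity and the
  equation both need derivatives of the same kernel. One derivative along an arbitrary direction
  \<open>(u, v, \<tau>)\<close> is computed and then specialised. The equation is then a balance of
  terms. With \<open>w = flow S t x - \<xi>\<close> and d the dimension, the time derivative
  contributes \<open>- d / (2 t)\<close> from the power law and \<open>|w|^2 / (4 a t^2)\<close>
  from the exponent. The Laplacian times \<open>a\<close> gives the same two terms: each of the d
  second derivatives carries \<open>- 1 / (2 a t)\<close>, and orthogonality makes the squared first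
  derivatives add up to \<open>|w|^2 / (2 a t)^2\<close>.\<close>

lemma sums_matrix_iff:
  fixes f :: "nat \<Rightarrow> 'a::real_normed_vector^'n^'m"
  shows "f sums M \<longleftrightarrow> (\<forall>i j. (\<lambda>k. f k $ i $ j) sums (M $ i $ j))"
proof
  assume "f sums M"
  then have "(\<lambda>n. (\<Sum>k<n. f k) $ i $ j) \<longlonglongrightarrow> M $ i $ j" for i j
    unfolding sums_def by (intro tendsto_vec_nth)
  then show "\<forall>i j. (\<lambda>k. f k $ i $ j) sums (M $ i $ j)"
    by (simp add: sums_def)
next
  assume *: "\<forall>i j. (\<lambda>k. f k $ i $ j) sums (M $ i $ j)"
  show "f sums M"
    unfolding sums_def
    by (intro vec_tendstoI) (use * in \<open>simp add: sums_def\<close>)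
qed

lemma matrix_exp_eqI: "(\<lambda>k. (1 / fact k) *\<^sub>R matrix_pow M k) sums X \<Longrightarrow> matrix_exp M = X"
  unfolding matrix_exp_def by (rule sums_unique[symmetric])

lemma matrix_pow_commute: "matrix_pow M k ** M = M ** matrix_pow M k"
  by (induction k) (simp_all add: matrix_mul_assoc[symmetric])

lemma matrix_pow_scaleR:
  fixes M :: "real^'n^'n"
  shows "matrix_pow (t *\<^sub>R M) k = t ^ k *\<^sub>R matrix_pow M k"
  by (induction k) (simp_all add: matrix_scalar_ac scalar_matrix_assoc[symmetric])

text \<open>One more factor \<open>M\<close> replaces an entry by \<open>CARD('n)\<close> products,
  each gaining at most a factor \<open>c\<close>. This gives a scalar exponential series as
  majorant.\<close>

lemma abs_matrix_pow_le:
  fixes M :: "real^'n^'n"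
  assumes "\<And>i j. \<bar>M $ i $ j\<bar> \<le> c"
  shows "\<bar>matrix_pow M k $ i $ j\<bar> \<le> (real CARD('n) * c) ^ k"
proof (induction k arbitrary: i j)
  case 0
  show ?case by (simp add: mat_def)
next
  case (Suc k)
  have "c \<ge> 0" using assms[of i j] by linarith
  have "\<bar>matrix_pow M (Suc k) $ i $ j\<bar> \<le> (\<Sum>l\<in>UNIV. \<bar>M $ i $ l\<bar> * \<bar>matrix_pow M k $ l $ j\<bar>)"
    by (simp add: matrix_matrix_mult_def abs_mult[symmetric])
  also have "\<dots> \<le> (\<Sum>l\<in>(UNIV::'n set). c * (real CARD('n) * c) ^ k)"
    by (intro sum_mono mult_mono assms Suc.IH \<open>c \<ge> 0\<close>) auto
  finally show ?case by (simp add: mult_ac)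
qed

lemma summable_matrix_pow_entry:
  fixes M :: "real^'n^'n"
  shows "summable (\<lambda>k. matrix_pow M k $ i $ j / fact k * t ^ k)"
proof -
  define c where "c = Max (range (\<lambda>(i, j). \<bar>M $ i $ j\<bar>))"
  have c: "\<bar>M $ i $ j\<bar> \<le> c" for i j
    unfolding c_def by (intro Max_ge) (auto intro: rev_image_eqI[of "(i, j)"])
  show ?thesis
  proof (rule summable_comparison_test'[where N = 0])
    show "summable (\<lambda>k. inverse (fact k) * (real CARD('n) * c * \<bar>t\<bar>) ^ k)"
      by (rule summable_exp)
    show "norm (matrix_pow M k $ i $ j / fact k * t ^ k)
        \<le> inverse (fact k) * (real CARD('n) * c * \<bar>t\<bar>) ^ k" for k
      using mult_right_mono[OF abs_matrix_pow_le[OF c, of k i j], of "\<bar>t\<bar> ^ k / fact k"]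
      by (simp add: abs_mult power_abs divide_inverse power_mult_distrib mult_ac)
  qed
qed

lemma matrix_exp_sums:
  fixes M :: "real^'n^'n"
  shows "(\<lambda>k. (1 / fact k) *\<^sub>R matrix_pow M k) sums matrix_exp M"
proof -
  have "(\<lambda>k. (1 / fact k) *\<^sub>R matrix_pow M k) sums
      (\<chi> i j. \<Sum>k. matrix_pow M k $ i $ j / fact k * 1 ^ k)"
    unfolding sums_matrix_iff
  proof (intro allI)
    fix i j
    from summable_sums[OF summable_matrix_pow_entry[of M i j 1]]
    show "(\<lambda>k. ((1 / fact k) *\<^sub>R matrix_pow M k) $ i $ j) sums
        ((\<chi> i j. \<Sum>k. matrix_pow M k $ i $ j / fact k * 1 ^ k) $ i $ j)"
      by simp
  qed
  with matrix_exp_eqI[OF this] show ?thesis by simp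
qed

lemma matrix_exp_scaleR_nth:
  fixes M :: "real^'n^'n"
  shows "matrix_exp (t *\<^sub>R M) $ i $ j = (\<Sum>k. matrix_pow M k $ i $ j / fact k * t ^ k)"
  using matrix_exp_sums[of "t *\<^sub>R M", unfolded sums_matrix_iff]
  by (auto simp: matrix_pow_scaleR intro!: sums_unique simp: mult_ac)

lemma matrix_exp_zero: "matrix_exp (0 :: real^'n^'n) = mat 1"
proof -
  have "(1 / fact k) *\<^sub>R matrix_pow 0 k = (if k \<in> {0} then mat 1 else (0 :: real^'n^'n))" for k
    by (cases k) (auto simp: matrix_matrix_mult_def vec_eq_iff)
  then show ?thesis
    using sums_If_finite_set[of "{0::nat}" "\<lambda>_. mat 1 :: real^'n^'n"]
    by (intro matrix_exp_eqI) simp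
qed

text \<open>Both products are sums of the same series, because \<open>M\<close> commutes with its
  own powers. The equation needs it: differentiating the flow in time produces \<open>S\<close> on
  the left of the exponential, the drift produces it on the right.\<close>

lemma matrix_exp_commute:
  fixes M :: "real^'n^'n"
  shows "matrix_exp (t *\<^sub>R M) ** M = M ** matrix_exp (t *\<^sub>R M)"
proof -
  have "(\<lambda>k. ((1 / fact k) *\<^sub>R matrix_pow (t *\<^sub>R M) k) ** M) sums (matrix_exp (t *\<^sub>R M) ** M)"
    using matrix_exp_sums[of "t *\<^sub>R M"] unfolding sums_matrix_iff matrix_matrix_mult_def vec_lambda_beta
    by (intro allI sums_sum sums_mult2) blast
  moreover have "(\<lambda>k. M ** ((1 / fact k) *\<^sub>R matrix_pow (t *\<^sub>R M) k)) sums (M ** matrix_exp (t *\<^sub>R M))"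
    using matrix_exp_sums[of "t *\<^sub>R M"] unfolding sums_matrix_iff matrix_matrix_mult_def vec_lambda_beta
    by (intro allI sums_sum sums_mult) blast
  moreover have "((1 / fact k) *\<^sub>R matrix_pow (t *\<^sub>R M) k) ** M
      = M ** ((1 / fact k) *\<^sub>R matrix_pow (t *\<^sub>R M) k)" for k
    by (simp add: matrix_pow_scaleR matrix_scalar_ac scalar_matrix_assoc[symmetric]
        matrix_pow_commute)
  ultimately show ?thesis
    by (simp add: sums_unique2)
qed

text \<open>Each entry is an everywhere convergent power series in \<open>t\<close>. Its
  differentiated coefficients are row \<open>i\<close> of \<open>M\<close> applied to the old ones,
  since (k+1)/(k+1)! = 1/k!.\<close>

lemma matrix_exp_has_real_derivative:
  fixes M :: "real^'n^'n"
  shows "((\<lambda>t. matrix_exp (t *\<^sub>R M) $ i $ j) has_real_derivative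
    (M ** matrix_exp (t *\<^sub>R M)) $ i $ j) (at t)"
proof -
  let ?c = "\<lambda>i j k. matrix_pow M k $ i $ j / fact k"
  have "diffs (?c i j) k = (\<Sum>l\<in>UNIV. M $ i $ l * ?c l j k)" for k
    by (simp add: diffs_def matrix_matrix_mult_def sum_divide_distrib sum_distrib_left del: of_nat_Suc)
  then have diffs: "diffs (?c i j) = (\<lambda>k. \<Sum>l\<in>UNIV. M $ i $ l * ?c l j k)"
    by blast
  have "(\<lambda>k. diffs (?c i j) k * t ^ k) sums (\<Sum>l\<in>UNIV. M $ i $ l * (\<Sum>k. ?c l j k * t ^ k))"
    unfolding diffs sum_distrib_right mult.assoc
    by (intro sums_sum sums_mult summable_sums summable_matrix_pow_entry)
  then have "(\<Sum>k. diffs (?c i j) k * t ^ k) = (M ** matrix_exp (t *\<^sub>R M)) $ i $ j"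
    unfolding matrix_matrix_mult_def matrix_exp_scaleR_nth vec_lambda_beta
    by (rule sums_unique[symmetric])
  then show ?thesis
    using termdiffs_strong_converges_everywhere[where c = "?c i j" and x = t, OF summable_matrix_pow_entry]
    by (simp add: matrix_exp_scaleR_nth)
qed

section \<open>The linear flow of a matrix and its isometry in the skew-symmetric case\<close>

lemma has_vector_derivative_vecI:
  fixes f :: "real \<Rightarrow> real^'n"
  assumes "\<And>i. ((\<lambda>t. f t $ i) has_real_derivative f' $ i) (at t)"
  shows "(f has_vector_derivative f') (at t)"
proof -
  have expand: "v = (\<Sum>i\<in>UNIV. v $ i *\<^sub>R axis i 1)" for v :: "real^'n"
    using basis_expansion[of v] by (simp add: scalar_mult_eq_scaleR)
  have "((\<lambda>t. \<Sum>i\<in>UNIV. f t $ i *\<^sub>R axis i 1) has_vector_derivative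
      (\<Sum>i\<in>UNIV. f' $ i *\<^sub>R (axis i 1 :: real^'n))) (at t)"
    using assms unfolding has_real_derivative_iff_has_vector_derivative
    by (intro has_vector_derivative_sum
        bounded_linear.has_vector_derivative[OF bounded_linear_scaleR_left])
  then show ?thesis
    unfolding expand[symmetric] .
qed

lemma matrix_exp_mult_vec_has_vector_derivative:
  fixes M :: "real^'n^'n"
  shows "((\<lambda>t. matrix_exp (t *\<^sub>R M) *v u) has_vector_derivative
    M *v (matrix_exp (t *\<^sub>R M) *v u)) (at t)"
proof (rule has_vector_derivative_vecI)
  fix i
  show "((\<lambda>t. (matrix_exp (t *\<^sub>R M) *v u) $ i) has_real_derivative
      (M *v (matrix_exp (t *\<^sub>R M) *v u)) $ i) (at t)"
    unfolding matrix_vector_mul_assoc unfolding matrix_vector_mult_def vec_lambda_beta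
    by (intro DERIV_sum DERIV_cmult_right matrix_exp_has_real_derivative)
qed

text \<open>The squared norm along the flow has derivative twice \<open>v \<bullet> (S *v v)\<close>
  with \<open>v\<close> on the orbit. This vanishes by skew-symmetry, so the value at time 0
  persists.\<close>

lemma norm_matrix_exp_skew:
  fixes S :: "real^'n^'n"
  assumes "transpose S = - S"
  shows "norm (matrix_exp (t *\<^sub>R S) *v u) = norm u"
proof -
  let ?F = "\<lambda>t. matrix_exp (t *\<^sub>R S) *v u"
  have skew: "v \<bullet> (S *v v) = 0" for v
  proof -
    have "v \<bullet> (S *v v) = (transpose S *v v) \<bullet> v"
      by (metis dot_lmul_matrix inner_commute transpose_matrix_vector)
    also have "\<dots> = - (v \<bullet> (S *v v))"
      using assms matrix_vector_mult_diff_rdistrib[of 0 S v] by (simp add: inner_commute)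
    finally show ?thesis by simp
  qed
  have "((\<lambda>t. ?F t \<bullet> ?F t) has_real_derivative 0) (at t)" for t
    unfolding has_real_derivative_iff_has_vector_derivative
    using bounded_bilinear.has_vector_derivative[OF bounded_bilinear_inner
        matrix_exp_mult_vec_has_vector_derivative[of S u t] matrix_exp_mult_vec_has_vector_derivative[of S u t]]
    by (simp add: skew inner_commute)
  then have "?F t \<bullet> ?F t = ?F 0 \<bullet> ?F 0"
    by (rule DERIV_isconst_all[rule_format])
  then show ?thesis
    by (simp add: matrix_exp_zero norm_eq_sqrt_inner)
qed

lemma orthogonal_matrix_exp_skew:
  fixes S :: "real^'n^'n"
  assumes "transpose S = - S"
  shows "orthogonal_matrix (matrix_exp (t *\<^sub>R S))"
proof -
  have "orthogonal_transformation ((*v) (matrix_exp (t *\<^sub>R S)))"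
    by (simp add: orthogonal_transformation norm_matrix_exp_skew[OF assms])
  then show ?thesis
    by (simp add: orthogonal_transformation_matrix)
qed

section \<open>Functions of a diagonalized matrix\<close>

text \<open>The scalar \<open>z\<close> is an argument of \<open>spectral_proj\<close> because the library has no multiplication of
  a complex matrix by a complex scalar.\<close>

definition spectral_proj :: "complex^'n^'n \<Rightarrow> 'n \<Rightarrow> complex \<Rightarrow> complex^'n^'n" where
  "spectral_proj Y k z = Y ** diag_matrix (\<lambda>l. if l = k then z else 0) ** matrix_inv Y"

lemma spectral_proj_nth: "spectral_proj Y k z $ i $ j = Y $ i $ k * z * matrix_inv Y $ k $ j"
  unfolding spectral_proj_def
  by (subst matrix_matrix_mult_def)
    (simp add: matrix_mult_diag_right if_distrib if_distribR cong: if_cong)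

lemma diag_conj_nth:
  "(Y ** diag_matrix l ** matrix_inv Y) $ i $ j = (\<Sum>k\<in>UNIV. Y $ i $ k * (l k :: complex) * matrix_inv Y $ k $ j)"
  by (subst matrix_matrix_mult_def) (simp add: matrix_mult_diag_right)

lemma diag_conj_eq_sum:
  fixes l :: "'n::finite \<Rightarrow> complex"
  shows "Y ** diag_matrix l ** matrix_inv Y = (\<Sum>k\<in>UNIV. spectral_proj Y k (l k))"
  by (simp add: vec_eq_iff diag_conj_nth spectral_proj_nth)

lemma diag_matrix_mult: "diag_matrix a ** diag_matrix b = diag_matrix (\<lambda>k. a k * (b k :: complex))"
  by (simp add: vec_eq_iff matrix_mult_diag_left) (simp add: diag_matrix_def)

lemma diag_conj_mult:
  fixes a b :: "'n::finite \<Rightarrow> complex"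
  assumes "invertible (Y :: complex^'n^'n)"
  shows "(Y ** diag_matrix a ** matrix_inv Y) ** (Y ** diag_matrix b ** matrix_inv Y)
    = Y ** diag_matrix (\<lambda>k. a k * b k) ** matrix_inv Y"
proof -
  have "(Y ** diag_matrix a ** matrix_inv Y) ** (Y ** diag_matrix b ** matrix_inv Y)
      = Y ** (diag_matrix a ** (matrix_inv Y ** Y) ** diag_matrix b) ** matrix_inv Y"
    by (simp only: matrix_mul_assoc)
  then show ?thesis
    by (simp add: matrix_inv_cancel[OF assms] diag_matrix_mult)
qed

lemma diag_conj_const:
  assumes "invertible (Y :: complex^'n^'n)"
  shows "Y ** diag_matrix (\<lambda>k. c) ** matrix_inv Y = mat c"
proof -
  have "(Y ** diag_matrix (\<lambda>k. c) ** matrix_inv Y) $ i $ j = c * (Y ** matrix_inv Y) $ i $ j" for i j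
    unfolding diag_conj_nth by (simp add: matrix_matrix_mult_def sum_distrib_left mult_ac)
  then show ?thesis
    by (simp add: matrix_inv_cancel[OF assms] vec_eq_iff mat_def)
qed

text \<open>In a power of a conjugated diagonal matrix the inner factors cancel, so every entry of
  the series is a finite combination of scalar exponential series.\<close>

lemma matrix_exp_diag_conj:
  fixes Y :: "complex^'n^'n"
  assumes "invertible Y"
  shows "matrix_exp (Y ** diag_matrix l ** matrix_inv Y) = Y ** diag_matrix (\<lambda>k. exp (l k)) ** matrix_inv Y"
proof (rule matrix_exp_eqI)
  have pow: "matrix_pow (Y ** diag_matrix l ** matrix_inv Y) m = Y ** diag_matrix (\<lambda>k. l k ^ m) ** matrix_inv Y" for m
  proof (induction m)
    case 0
    show ?case by (simp add: diag_conj_const[OF assms])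
  next
    case (Suc m)
    then show ?case by (simp add: diag_conj_mult[OF assms])
  qed
  have "(\<lambda>m. (1 / fact m) *\<^sub>R (\<Sum>k\<in>UNIV. Y $ i $ k * l k ^ m * matrix_inv Y $ k $ j)) sums
      (\<Sum>k\<in>UNIV. Y $ i $ k * exp (l k) * matrix_inv Y $ k $ j)" for i j
  proof -
    have "(\<lambda>m. \<Sum>k\<in>UNIV. Y $ i $ k * (l k ^ m /\<^sub>R fact m) * matrix_inv Y $ k $ j) sums
      (\<Sum>k\<in>UNIV. Y $ i $ k * exp (l k) * matrix_inv Y $ k $ j)"
      by (intro sums_sum sums_mult sums_mult2 exp_converges)
    moreover have "(1 / fact m) *\<^sub>R (\<Sum>k\<in>UNIV. Y $ i $ k * l k ^ m * matrix_inv Y $ k $ j)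
        = (\<Sum>k\<in>UNIV. Y $ i $ k * (l k ^ m /\<^sub>R fact m) * matrix_inv Y $ k $ j)" for m
      by (simp add: scaleR_sum_right inverse_eq_divide)
    ultimately show ?thesis
      by (simp only:)
  qed
  then show "(\<lambda>m. (1 / fact m) *\<^sub>R matrix_pow (Y ** diag_matrix l ** matrix_inv Y) m) sums
      (Y ** diag_matrix (\<lambda>k. exp (l k)) ** matrix_inv Y)"
    unfolding pow sums_matrix_iff vector_scaleR_component diag_conj_nth by blast
qed

lemma matrix_inv_diag_conj:
  fixes Y :: "complex^'n^'n"
  assumes Y: "invertible Y" and "\<And>k. l k \<noteq> 0"
  shows "matrix_inv (Y ** diag_matrix l ** matrix_inv Y) = Y ** diag_matrix (\<lambda>k. inverse (l k)) ** matrix_inv Y"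
    (is "matrix_inv ?M = ?N")
proof -
  have MN: "?M ** ?N = mat 1" and "?N ** ?M = mat 1"
    unfolding diag_conj_mult[OF Y] using assms by (simp_all add: diag_conj_const[OF Y])
  then have M: "invertible ?M" unfolding invertible_def by blast
  have "matrix_inv ?M = matrix_inv ?M ** (?M ** ?N)"
    unfolding MN by (rule matrix_mul_rid[symmetric])
  also have "\<dots> = (matrix_inv ?M ** ?M) ** ?N"
    by (rule matrix_mul_assoc)
  also have "\<dots> = ?N"
    unfolding matrix_inv_cancel[OF M] by (rule matrix_mul_lid)
  finally show ?thesis .
qed

lemma diag_conj_scaleR:
  fixes Y :: "complex^'n^'n"
  shows "r *\<^sub>R (Y ** diag_matrix l ** matrix_inv Y) = Y ** diag_matrix (\<lambda>k. of_real r * l k) ** matrix_inv Y"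
  unfolding vec_eq_iff vector_scaleR_component diag_conj_nth
  by (simp add: sum_distrib_left scaleR_conv_of_real mult_ac)

lemma diag_conj_minus:
  fixes Y :: "complex^'n^'n"
  shows "- (Y ** diag_matrix l ** matrix_inv Y) = Y ** diag_matrix (\<lambda>k. - l k) ** matrix_inv Y"
  unfolding vec_eq_iff vector_uminus_component diag_conj_nth
  by (simp add: sum_negf)

lemma diag_conj_diff:
  fixes Y :: "complex^'n^'n"
  shows "(Y ** diag_matrix l ** matrix_inv Y) - (Y ** diag_matrix m ** matrix_inv Y)
    = Y ** diag_matrix (\<lambda>k. l k - m k) ** matrix_inv Y"
  unfolding vec_eq_iff vector_minus_component diag_conj_nth
  by (simp add: left_diff_distrib right_diff_distrib sum_subtractf)

lemma diag_matrix_mult_vec: "(diag_matrix l *v v) $ i = (l i :: complex) * v $ i"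
  by (simp add: matrix_vector_mult_def diag_matrix_def if_distrib if_distribR cong: if_cong)

text \<open>The eigenvector is column \<open>k\<close> of \<open>Y\<close>. This turns the
  hypothesis on eigenvalues into \<open>Re (a k) > 0\<close> for the diagonal entries.\<close>

lemma matrix_eigenvalue_diag_conj:
  fixes Y :: "complex^'n^'n"
  assumes Y: "invertible Y"
  shows "matrix_eigenvalue (Y ** diag_matrix l ** matrix_inv Y) (l k)"
  unfolding matrix_eigenvalue_def
proof (intro exI conjI)
  have inv: "matrix_inv Y *v (Y *v axis k 1) = axis k 1"
    unfolding matrix_vector_mul_assoc matrix_inv_cancel[OF Y] by (rule matrix_vector_mul_lid)
  then show "Y *v axis k 1 \<noteq> 0"
    by (metis axis_eq_0_iff matrix_vector_mult_0_right zero_neq_one)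
  have "(Y ** diag_matrix l ** matrix_inv Y) *v (Y *v axis k 1) = Y *v (diag_matrix l *v axis k 1)"
    by (simp only: matrix_vector_mul_assoc[symmetric] inv)
  also have "diag_matrix l *v axis k 1 = l k *s axis k 1"
    by (simp add: vec_eq_iff diag_matrix_mult_vec axis_def)
  finally show "(Y ** diag_matrix l ** matrix_inv Y) *v (Y *v axis k 1) = l k *s (Y *v axis k 1)"
    by (simp add: vector_scalar_commute)
qed

text \<open>Through this, continuity, derivatives, limits and integrals pass from the scalar kernels
  to the matrix kernel.\<close>

lemma bounded_linear_spectral_proj: "bounded_linear (spectral_proj Y k)"
proof -
  have "linear (spectral_proj Y k)"
    by (rule linearI) (simp_all add: vec_eq_iff spectral_proj_nth algebra_simps)
  then show ?thesis by (simp add: linear_conv_bounded_linear)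
qed

section \<open>The complex Gaussian integral\<close>

text \<open>The right side is the central binomial coefficient times \<open>(u / 4) ^ k\<close>.
  Both sides have the same quotient of successive terms. This form is the one produced by the even
  Gaussian moments divided by the factorials of the exponential series.\<close>

lemma gbinomial_minus_half:
  fixes u :: "'a::field_char_0"
  shows "((-1/2) gchoose k) * (- u) ^ k = fact (2 * k) / (4 ^ k * fact k * fact k) * u ^ k"
proof (induction k)
  case (Suc k)
  define c :: 'a where "c = of_nat (Suc k)"
  define G where "G k = ((-1/2 :: 'a) gchoose k)" for k
  have c: "c \<noteq> 0" unfolding c_def by (rule of_nat_neq_0)
  have n: "of_nat k = c - 1" by (simp add: c_def)
  have rec: "c * G (Suc k) = (1/2 - c) * G k"
  proof -
    have "c * G (Suc k) = (-1/2) * G k - (c - 1) * G k"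
      using gbinomial_mult_1[of "-1/2 :: 'a" k]
      unfolding G_def[symmetric] c_def[symmetric] n by (simp only: add_diff_cancel_left')
    also have "\<dots> = (-1/2 - (c - 1)) * G k"
      by (simp only: left_diff_distrib)
    also have "-1/2 - (c - 1) = 1/2 - c" by simp
    finally show ?thesis .
  qed
  \<comment> \<open>Here d = k + 1/2 and c = k + 1, so that (2k+1)(2k+2) = 4cd. The recursion
    \<open>rec\<close> carries the factor \<open>- d\<close>, whose sign is absorbed by
    \<open>- u\<close>.\<close>
  define d where "d = c - 1/2"
  have f: "(fact (Suc k) :: 'a) = c * fact k" "(fact (2 * Suc k) :: 'a) = 4 * c * d * fact (2 * k)"
    by (simp_all add: c_def d_def algebra_simps)
  have "c * (G (Suc k) * (- u) ^ Suc k) = (c * G (Suc k)) * (- u * (- u) ^ k)"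
    by (simp only: mult.assoc power_Suc)
  also have "\<dots> = d * u * (G k * (- u) ^ k)"
    unfolding rec d_def by (simp only: mult_ac minus_mult_left[symmetric] minus_mult_right minus_diff_eq)
  also have "\<dots> = c * (fact (2 * Suc k) / (4 ^ Suc k * fact (Suc k) * fact (Suc k)) * u ^ Suc k)"
    unfolding Suc.IH[folded G_def] f using c by (simp add: mult_ac)
  finally show ?case
    unfolding G_def by (rule mult_left_cancel[OF c, THEN iffD1])
qed simp

lemma gaussian_even_moment:
  "has_bochner_integral lborel (\<lambda>s::real. exp (- s\<^sup>2) * s ^ (2 * k))
     (sqrt pi * (fact (2 * k) / (4 ^ k * fact k)))"
  using has_bochner_integral_even_function[OF gaussian_moment_even_pos[where k = k]]
  by (simp add: power_mult)

text \<open>Write \<open>exp (- z s\<^sup>2) = exp (- s\<^sup>2) exp ((1 - z) s\<^sup>2)\<close> and expand the second factor: integrating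
  termwise gives the binomial series of \<open>(1 - (1 - z)) powr (-1/2)\<close>. The coefficients are positive, so
  the same series at \<open>\<bar>1 - z\<bar>\<close> justifies the interchange.\<close>

lemma has_bochner_integral_complex_gaussian_near_1:
  fixes z :: complex
  assumes "norm (1 - z) < 1"
  shows "has_bochner_integral lborel (\<lambda>s. exp (- z * of_real (s\<^sup>2))) (sqrt pi * z powr (-1/2))"
proof -
  define w where "w = 1 - z"
  define f :: "nat \<Rightarrow> real \<Rightarrow> complex"
    where "f k s = w ^ k / fact k * of_real (exp (- s\<^sup>2) * s ^ (2 * k))" for k s
  define c :: "nat \<Rightarrow> real" where "c k = sqrt pi * (fact (2 * k) / (4 ^ k * fact k)) / fact k" for k
  have w: "norm w < 1" using assms by (simp add: w_def)
  have f: "has_bochner_integral lborel (f k) (of_real (c k) * w ^ k)" for k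
    using has_bochner_integral_mult_right[OF has_bochner_integral_of_real[OF gaussian_even_moment[of k]], of "w ^ k / fact k"]
    by (simp add: f_def[abs_def] c_def mult_ac)
  have norm_f_eq: "norm (f k s) = norm w ^ k / fact k * (exp (- s\<^sup>2) * s ^ (2 * k))" for k s
    by (simp add: f_def norm_mult norm_divide norm_power abs_mult power_even_abs power_abs
        del: of_real_mult of_real_power)
  have norm_f: "has_bochner_integral lborel (\<lambda>s. norm (f k s)) (c k * norm w ^ k)" for k
    using has_bochner_integral_mult_right[OF gaussian_even_moment[of k], of "norm w ^ k / fact k"]
    by (simp add: norm_f_eq c_def mult_ac)
  have c_eq: "of_real (c k) * u ^ k = of_real (sqrt pi) * ((-1/2 gchoose k) * (- u) ^ k)" for k and u :: complex
    unfolding gbinomial_minus_half by (simp add: c_def)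
  have c_eq': "c k * u ^ k = sqrt pi * ((-1/2 gchoose k) * (- u) ^ k)" for k and u :: real
    unfolding gbinomial_minus_half by (simp add: c_def)
  have exp_sums: "(\<lambda>k. f k s) sums exp (- z * of_real (s\<^sup>2))" for s
  proof -
    have "(\<lambda>k. exp (- of_real (s\<^sup>2)) * ((w * of_real (s\<^sup>2)) ^ k /\<^sub>R fact k)) sums
        (exp (- of_real (s\<^sup>2)) * exp (w * of_real (s\<^sup>2)))"
      by (intro sums_mult exp_converges)
    also have "exp (- of_real (s\<^sup>2)) * exp (w * of_real (s\<^sup>2)) = exp (- z * of_real (s\<^sup>2))"
      by (simp add: w_def exp_add[symmetric] algebra_simps)
    also have "(\<lambda>k. exp (- of_real (s\<^sup>2)) * ((w * of_real (s\<^sup>2)) ^ k /\<^sub>R fact k)) = (\<lambda>k. f k s)"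
      by (simp add: f_def scaleR_conv_of_real power_mult power_mult_distrib divide_inverse
          exp_of_real[symmetric] fun_eq_iff)
    finally show ?thesis .
  qed
  have summ: "AE s in lborel. summable (\<lambda>k. norm (f k s))"
  proof (intro AE_I2)
    fix s :: real
    have "summable (\<lambda>k. exp (- s\<^sup>2) * (inverse (fact k) * (norm w * s\<^sup>2) ^ k))"
      by (intro summable_mult summable_exp)
    then show "summable (\<lambda>k. norm (f k s))"
      unfolding norm_f_eq power_mult power_mult_distrib by (simp add: divide_inverse mult_ac)
  qed
  have summ': "summable (\<lambda>k. \<integral>s. norm (f k s) \<partial>lborel)"
    unfolding has_bochner_integral_integral_eq[OF norm_f] c_eq'
    using gen_binomial_real[of "- norm w" "-1/2"] w
    by (intro summable_mult) (auto simp: sums_iff)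
  have int: "integrable lborel (f k)" for k
    using f by (rule integrable.intros)
  have "(\<lambda>k. \<integral>s. f k s \<partial>lborel) sums (\<integral>s. (\<Sum>k. f k s) \<partial>lborel)"
    using int summ summ' by (rule sums_integral)
  moreover have "(\<lambda>k. \<integral>s. f k s \<partial>lborel) sums (of_real (sqrt pi) * (1 + - w) powr (-1/2))"
    unfolding has_bochner_integral_integral_eq[OF f] c_eq
    by (intro sums_mult gen_binomial_complex) (use w in simp)
  ultimately have "(\<integral>s. (\<Sum>k. f k s) \<partial>lborel) = of_real (sqrt pi) * z powr (-1/2)"
    by (auto simp: w_def dest: sums_unique2)
  moreover have "integrable lborel (\<lambda>s. \<Sum>k. f k s)"
    using int summ summ' by (rule integrable_suminf)
  moreover have "(\<Sum>k. f k s) = exp (- z * of_real (s\<^sup>2))" for s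
    using exp_sums by (rule sums_unique[symmetric])
  ultimately show ?thesis
    by (simp add: has_bochner_integral_iff)
qed

text \<open>Every open ray from 0 in the right half-plane meets the disc of radius 1 around 1, and a
  positive real factor comes out of a principal power without branch error.\<close>

lemma has_bochner_integral_complex_gaussian:
  fixes z :: complex
  assumes "Re z > 0"
  shows "has_bochner_integral lborel (\<lambda>s. exp (- z * of_real (s\<^sup>2))) (sqrt pi * z powr (-1/2))"
proof -
  \<comment> \<open>This choice gives \<open>\<bar>1 - z / c\<bar> < 1\<close>, and \<open>z\<close> is reduced to \<open>z / c\<close> by rescaling \<open>s\<close>.\<close>
  define c where "c = (norm z)\<^sup>2 / Re z"
  have "z \<noteq> 0" using assms by auto
  then have c: "c > 0" using assms by (simp add: c_def)
  \<comment> \<open>The point \<open>z / c\<close> is the orthogonal projection of 1 onto the ray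
    through \<open>z\<close>. By Pythagoras its squared distance to 1 is
    \<open>1 - Re z / c\<close>.\<close>
  have "(norm (1 - z / of_real c))\<^sup>2 = 1 - 2 * (Re z / c) + (norm z / c)\<^sup>2"
    using c by (simp add: cmod_power2 power_divide add_divide_distrib)
      (simp add: power2_eq_square algebra_simps)
  also have "(norm z / c)\<^sup>2 = Re z / c"
    using assms \<open>z \<noteq> 0\<close> by (simp add: c_def power2_eq_square field_simps)
  finally have "(norm (1 - z / of_real c))\<^sup>2 < 1\<^sup>2" using assms c by simp
  then have "norm (1 - z / of_real c) < 1"
    by (rule power2_less_imp_less) simp
  from has_bochner_integral_complex_gaussian_near_1[OF this]
  have *: "has_bochner_integral lborel (\<lambda>s. exp (- (z / of_real c) * of_real ((0 + sqrt c * s)\<^sup>2)))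
      ((sqrt pi * (z / of_real c) powr (-1/2)) /\<^sub>R \<bar>sqrt c\<bar>)"
    using c by (subst (asm) lborel_has_bochner_integral_real_affine_iff[where c = "sqrt c" and t = 0]) auto
  have "z powr (-1/2) = (of_real c * (z / of_real c)) powr (-1/2)"
    using c by simp
  also have "\<dots> = of_real c powr (-1/2) * (z / of_real c) powr (-1/2)"
    using c by (subst powr_times_real_left) auto
  also have "of_real c powr (-1/2) = (of_real (c powr (-1/2)) :: complex)"
    using c powr_of_real[of c "-1/2"] by simp
  also have "c powr (-1/2) = inverse (sqrt c)"
    using c by (simp add: powr_minus powr_half_sqrt)
  finally have z: "z powr (-1/2) = (z / of_real c) powr (-1/2) /\<^sub>R sqrt c"
    by (simp add: scaleR_conv_of_real)
  have "- (z / of_real c) * of_real ((0 + sqrt c * s)\<^sup>2) = - z * of_real (s\<^sup>2)" for s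
    using c by (simp add: power_mult_distrib flip: of_real_power)
  moreover have "(of_real (sqrt pi) * (z / of_real c) powr (-1/2)) /\<^sub>R \<bar>sqrt c\<bar>
      = of_real (sqrt pi) * z powr (-1/2)"
    using c unfolding z by simp
  ultimately show ?thesis
    using * by simp
qed

text \<open>Fubini for products of one-variable functions: \<open>lborel_eq\<close> presents
  Lebesgue measure as the image of a product measure over \<open>Basis\<close> under the coordinate
  sum.\<close>

lemma has_bochner_integral_lborel_prod:
  fixes f :: "'a::euclidean_space \<Rightarrow> real \<Rightarrow> complex"
  assumes f: "\<And>b. b \<in> Basis \<Longrightarrow> has_bochner_integral lborel (f b) (I b)"
  shows "has_bochner_integral lborel (\<lambda>x. \<Prod>b\<in>Basis. f b (x \<bullet> b)) (\<Prod>b\<in>Basis. I b)"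
proof -
  interpret product_sigma_finite "\<lambda>_::'a. lborel :: real measure" ..
  let ?P = "\<Pi>\<^sub>M b\<in>Basis. lborel :: ('a \<Rightarrow> real) measure"
  have int: "integrable lborel (f b)" and I: "integral\<^sup>L lborel (f b) = I b" if "b \<in> Basis" for b
    using f[OF that] by (auto simp: has_bochner_integral_iff)
  have "has_bochner_integral ?P (\<lambda>x. \<Prod>b\<in>Basis. f b (x b)) (\<Prod>b\<in>Basis. I b)"
    using product_integrable_prod[of Basis f] product_integral_prod[of Basis f] int I
    by (simp add: has_bochner_integral_iff)
  moreover have "(\<lambda>x. \<Prod>b\<in>Basis. f b (x \<bullet> b)) \<in> borel_measurable borel"
  proof (rule borel_measurable_prod)
    fix b :: 'a assume "b \<in> Basis"
    then have "f b \<in> borel_measurable borel"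
      using borel_measurable_integrable[OF int] by simp
    then show "(\<lambda>x. f b (x \<bullet> b)) \<in> borel_measurable borel"
      by (rule measurable_compose[rotated]) simp
  qed
  moreover have "(\<lambda>f. \<Sum>b\<in>Basis. f b *\<^sub>R b) \<in> measurable ?P (borel :: 'a measure)"
    by measurable
  moreover have "(\<Prod>b\<in>Basis. f b ((\<Sum>c\<in>Basis. x c *\<^sub>R c) \<bullet> b)) = (\<Prod>b\<in>Basis. f b (x b))" for x
    by (intro prod.cong refl) simp
  ultimately have "has_bochner_integral (distr ?P borel (\<lambda>f. \<Sum>b\<in>Basis. f b *\<^sub>R b))
      (\<lambda>x. \<Prod>b\<in>Basis. f b (x \<bullet> b)) (\<Prod>b\<in>Basis. I b)"
    by (subst has_bochner_integral_distr) simp_all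
  then show ?thesis
    by (subst lborel_eq)
qed

lemma has_bochner_integral_complex_gaussian_euclidean:
  fixes z :: complex
  assumes "Re z > 0"
  shows "has_bochner_integral lborel (\<lambda>y::'a::euclidean_space. exp (- z * of_real ((norm y)\<^sup>2)))
    ((pi / z) powr (of_nat DIM('a) / 2))"
proof -
  have z: "z \<noteq> 0" using assms by auto
  have "(\<Prod>b\<in>(Basis :: 'a set). sqrt pi * z powr (-1/2)) = (pi / z) powr (of_nat DIM('a) / 2)"
  proof -
    have "sqrt pi * z powr (-1/2) = (of_real pi * inverse z) powr (1/2)"
    proof -
      have "(of_real pi * inverse z) powr (1/2) = of_real pi powr (1/2) * (inverse z) powr (1/2)"
        by (subst powr_times_real_left) auto
      also have "of_real pi powr (1/2) = complex_of_real (sqrt pi)"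
        using powr_of_real[of pi "1/2"] by (simp add: powr_half_sqrt)
      \<comment> \<open>\<open>Ln (inverse z) = - Ln z\<close> fails on the negative real axis,
        which \<open>Re z > 0\<close> excludes.\<close>
      also have "(inverse z) powr (1/2) = z powr (-1/2)"
        using z assms by (simp add: powr_def Ln_inverse complex_nonpos_Reals_iff)
      finally show ?thesis by simp
    qed
    \<comment> \<open>An integer power of a principal power is safe: both sides are the exponential
      of \<open>n / 2\<close> times the same \<open>Ln w\<close>.\<close>
    moreover have "(w powr (1/2)) ^ n = w powr (of_nat n / 2)" if "w \<noteq> 0" for w :: complex and n
      using that by (simp add: powr_def flip: exp_of_nat_mult)
    ultimately show ?thesis
      using z by (simp only: prod_constant divide_inverse[of "of_real pi"]) simp
  qed
  moreover have "(\<Prod>b\<in>Basis. exp (- z * of_real ((y \<bullet> b)\<^sup>2))) = exp (- z * of_real ((norm y)\<^sup>2))" for y :: 'a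
    by (simp add: exp_sum[symmetric] sum_distrib_left norm_eq_sqrt_inner euclidean_inner[of y y] power2_eq_square sum_nonneg sum_negf)
  ultimately show ?thesis
    using has_bochner_integral_lborel_prod[where 'a='a and f = "\<lambda>_ s. exp (- z * of_real (s\<^sup>2))",
        OF has_bochner_integral_complex_gaussian[OF assms]]
    by simp
qed

section \<open>The scalar kernels\<close>

abbreviation flow :: "real^'d^'d \<Rightarrow> real \<Rightarrow> real^'d \<Rightarrow> real^'d" where
  "flow S t x \<equiv> matrix_exp (t *\<^sub>R S) *v x"

definition scalar_kernel ::
    "real^'d^'d \<Rightarrow> complex \<Rightarrow> complex \<Rightarrow> real^'d \<Rightarrow> real^'d \<Rightarrow> real \<Rightarrow> complex" where
  "scalar_kernel S a b x \<xi> t = (4 * of_real pi * of_real t * a) powr (- (of_nat CARD('d) / 2)) *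
     exp (- (of_real t * b) - of_real ((norm (flow S t x - \<xi>))\<^sup>2) / (4 * of_real t * a))"

text \<open>The flow is linear in space, so the curve splits into the orbit of \<open>x\<close> and
  \<open>s\<close> times the orbit of \<open>u\<close>. At \<open>s = 0\<close> the product rule
  keeps only \<open>flow S t u\<close> from the second part.\<close>

lemma flow_along_has_vector_derivative:
  "((\<lambda>s. flow S (t + s * \<tau>) (x + s *\<^sub>R u)) has_vector_derivative
     flow S t u + \<tau> *\<^sub>R (S *v flow S t x)) (at 0)"
proof -
  have time: "((\<lambda>s. t + s * \<tau>) has_vector_derivative \<tau>) (at 0)"
    by (auto intro!: derivative_eq_intros)
  have along: "((\<lambda>s. flow S (t + s * \<tau>) v) has_vector_derivative \<tau> *\<^sub>R (S *v flow S t v)) (at 0)" for v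
    using vector_diff_chain_at[OF time, where g = "\<lambda>t. flow S t v"]
      matrix_exp_mult_vec_has_vector_derivative[of S v t]
    by (simp add: o_def)
  have "((\<lambda>s. flow S (t + s * \<tau>) x + s *\<^sub>R flow S (t + s * \<tau>) u) has_vector_derivative
      \<tau> *\<^sub>R (S *v flow S t x) + (0 *\<^sub>R (\<tau> *\<^sub>R (S *v flow S t u)) + 1 *\<^sub>R flow S (t + 0 * \<tau>) u)) (at 0)"
    by (intro has_vector_derivative_add has_vector_derivative_scaleR along) (auto intro!: derivative_eq_intros)
  then show ?thesis
    by (simp add: matrix_vector_right_distrib matrix_vector_mult_scaleR add.commute)
qed

text \<open>The base of the power law stays off the branch cut, so its principal power is
  differentiable.\<close>

lemma heat_factor_not_nonpos:
  assumes "t > 0" "Re a > 0"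
  shows "4 * of_real pi * of_real t * a \<notin> \<real>\<^sub>\<le>\<^sub>0"
proof -
  have "pi * (t * Re a) > 0" using assms by simp
  then show ?thesis by (simp add: complex_nonpos_Reals_iff mult.assoc)
qed

lemma power_law_has_vector_derivative:
  assumes "t > 0" "Re a > 0"
  shows "((\<lambda>t. (4 * of_real pi * of_real t * a) powr p) has_vector_derivative
    p / of_real t * (4 * of_real pi * of_real t * a) powr p) (at t)"
proof -
  have nz: "4 * of_real pi * of_real t * a \<notin> \<real>\<^sub>\<le>\<^sub>0" "a \<noteq> 0"
    using assms heat_factor_not_nonpos[OF assms] by auto
  have "((\<lambda>z. (4 * of_real pi * z * a) powr p) has_field_derivative
      p / of_real t * (4 * of_real pi * of_real t * a) powr p) (at (of_real t))"
    using assms nz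
    by (auto intro!: derivative_eq_intros simp: powr_diff)
  then show ?thesis
    by (rule has_vector_derivative_real_field)
qed

text \<open>One formula serves three uses: \<open>\<tau> = 0\<close>, \<open>v = 0\<close> gives the
  space derivatives, \<open>u = v = 0\<close>, \<open>\<tau> = 1\<close> the time derivative, and a
  general direction the closure of \<open>kernel_alg\<close>. The vector \<open>w'\<close> is the
  velocity of the displacement \<open>w\<close>.\<close>

lemma scalar_kernel_along_has_vector_derivative:
  fixes S :: "real^'d^'d" and x \<xi> u v :: "real^'d" and \<tau> t :: real
  assumes t: "t > 0" and a: "Re a > 0"
  defines "w \<equiv> flow S t x - \<xi>" and "w' \<equiv> flow S t u + \<tau> *\<^sub>R (S *v flow S t x) - v"
  shows "((\<lambda>s. scalar_kernel S a b (x + s *\<^sub>R u) (\<xi> + s *\<^sub>R v) (t + s * \<tau>)) has_vector_derivative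
    scalar_kernel S a b x \<xi> t *
      (of_real \<tau> * (- (of_nat CARD('d) / 2) / of_real t - b + of_real (w \<bullet> w) / (4 * a * of_real t * of_real t))
       - of_real (w \<bullet> w') / (2 * a * of_real t))) (at 0)"
proof -
  let ?p = "- (of_nat CARD('d) / 2) :: complex"
  define W where "W s = flow S (t + s * \<tau>) (x + s *\<^sub>R u) - (\<xi> + s *\<^sub>R v)" for s
  define P where "P s = (4 * of_real pi * of_real (t + s * \<tau>) * a) powr ?p" for s
  have nz: "of_real t \<noteq> (0::complex)" "a \<noteq> 0" using t a by auto
  have W0: "W 0 = w" by (simp add: W_def w_def)
  have time: "((\<lambda>s. t + s * \<tau>) has_vector_derivative \<tau>) (at 0)"
    by (auto intro!: derivative_eq_intros)
  have W: "(W has_vector_derivative w') (at 0)"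
    unfolding W_def[abs_def] w'_def
    by (intro has_vector_derivative_diff flow_along_has_vector_derivative) (auto intro!: derivative_eq_intros)
  have "((\<lambda>s. W s \<bullet> W s) has_vector_derivative 2 * (w \<bullet> w')) (at 0)"
    using bounded_bilinear.has_vector_derivative[OF bounded_bilinear_inner W W]
    by (simp add: W0 inner_commute)
  then have R: "((\<lambda>s. complex_of_real (W s \<bullet> W s)) has_vector_derivative of_real (2 * (w \<bullet> w'))) (at 0)"
    by (intro has_vector_derivative_of_real) (simp add: has_real_derivative_iff_has_vector_derivative)
  have T: "((\<lambda>s. complex_of_real (t + s * \<tau>)) has_vector_derivative of_real \<tau>) (at 0)"
    using time by (intro has_vector_derivative_of_real) (simp add: has_real_derivative_iff_has_vector_derivative)
  have P: "(P has_vector_derivative of_real \<tau> * (?p / of_real t * P 0)) (at 0)"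
  proof -
    have "((\<lambda>t. (4 * of_real pi * of_real t * a) powr ?p) \<circ> (\<lambda>s. t + s * \<tau>) has_vector_derivative
        \<tau> *\<^sub>R (?p / of_real t * P 0)) (at 0)"
      by (rule vector_diff_chain_at[OF time])
        (use power_law_has_vector_derivative[OF t a, of ?p] in \<open>simp add: P_def\<close>)
    then show ?thesis
      by (simp add: o_def P_def[abs_def] scaleR_conv_of_real)
  qed
  have inv: "((\<lambda>s. inverse (complex_of_real (t + s * \<tau>))) has_vector_derivative
      of_real \<tau> * (- inverse (of_real t) * inverse (of_real t))) (at 0)"
    using field_vector_diff_chain_at[OF T, where g = inverse and g' = "- inverse (of_real t) * inverse (of_real t)"] nz
      DERIV_inverse'[OF DERIV_ident, of "complex_of_real t"]
    by (simp add: o_def)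
  define Q where "Q s = - (complex_of_real (t + s * \<tau>) * b)
      - of_real (W s \<bullet> W s) * inverse (complex_of_real (t + s * \<tau>)) * inverse (4 * a)" for s
  define Q' where "Q' = - (of_real \<tau> * b) - (of_real (w \<bullet> w) * (of_real \<tau> * (- inverse (of_real t) * inverse (of_real t)))
      + of_real (2 * (w \<bullet> w')) * inverse (of_real t)) * inverse (4 * a)"
  have Q: "(Q has_vector_derivative Q') (at 0)"
    unfolding Q_def[abs_def] Q'_def
    using has_vector_derivative_mult[OF R inv]
    by (intro has_vector_derivative_diff has_vector_derivative_minus has_vector_derivative_mult_left T)
      (simp add: W0)
  have eQ: "((\<lambda>s. exp (Q s)) has_vector_derivative Q' * exp (Q 0)) (at 0)"
    using field_vector_diff_chain_at[OF Q DERIV_exp] by (simp add: o_def)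
  have K: "scalar_kernel S a b (x + s *\<^sub>R u) (\<xi> + s *\<^sub>R v) (t + s * \<tau>) = P s * exp (Q s)" for s
    by (simp only: scalar_kernel_def P_def Q_def W_def dot_square_norm divide_inverse
        inverse_mult_distrib mult.assoc mult.commute mult.left_commute)
  have K0: "scalar_kernel S a b x \<xi> t = P 0 * exp (Q 0)"
    using K[of 0] by simp
  have "P 0 * (Q' * exp (Q 0)) + (of_real \<tau> * (?p / of_real t * P 0)) * exp (Q 0)
      = P 0 * exp (Q 0) *
      (of_real \<tau> * (?p / of_real t - b + of_real (w \<bullet> w) / (4 * a * of_real t * of_real t))
       - of_real (w \<bullet> w') / (2 * a * of_real t))"
  proof -
    have "Q' = of_real \<tau> * (- b + of_real (w \<bullet> w) / (4 * a * of_real t * of_real t))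
        - of_real (w \<bullet> w') / (2 * a * of_real t)"
      unfolding Q'_def of_real_mult using nz by (simp add: divide_simps) (simp add: algebra_simps)
    then show ?thesis by (simp only: ring_distribs diff_conv_add_uminus mult_ac add_ac)
  qed
  then show ?thesis
    unfolding K K0 using has_vector_derivative_mult[OF P eQ] by simp
qed

text \<open>Power, inverse, exponential and product all act on the diagonal entries in the common
  basis given by \<open>Y\<close>. The matrix expression collapses to one conjugated diagonal matrix
  whose entries are literally the scalar kernels.\<close>

lemma matrix_kernel_eq_sum:
  fixes Y :: "complex^'n^'n" and x \<xi> :: "real^'d"
  assumes Y: "invertible Y" and t: "t > 0" and a: "\<And>k. Re (a k) > 0"
    and A: "A = Y ** diag_matrix a ** matrix_inv Y" and B: "B = Y ** diag_matrix b ** matrix_inv Y"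
  shows "matrix_powr ((4 * pi * t) *\<^sub>R A) (- (of_nat CARD('d) / 2)) **
       matrix_exp (- (t *\<^sub>R B) - (norm (flow S t x - \<xi>))\<^sup>2 *\<^sub>R matrix_inv ((4 * t) *\<^sub>R A))
     = (\<Sum>k\<in>UNIV. spectral_proj Y k (scalar_kernel S (a k) (b k) x \<xi> t))"
proof -
  have nz: "of_real (4 * t) * a k \<noteq> 0" for k
    using a[of k] t by auto
  show ?thesis
    unfolding A B diag_conj_scaleR matrix_powr_diag[OF Y] matrix_inv_diag_conj[OF Y nz] diag_conj_minus
      diag_conj_diff matrix_exp_diag_conj[OF Y] diag_conj_mult[OF Y]
    unfolding diag_conj_eq_sum scalar_kernel_def divide_inverse of_real_mult of_real_numeral
    by (rule refl)
qed

section \<open>Smoothness\<close>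

text \<open>\<open>kernel_alg\<close> is an algebra of functions of \<open>p = (x, \<xi>, t)\<close> that contains the scalar kernel and
  is closed under all directional derivatives; continuity of its members thus yields all the
  regularity at once.\<close>

inductive_set kernel_alg ::
    "real^'d^'d \<Rightarrow> complex \<Rightarrow> complex \<Rightarrow> ((real^'d) \<times> (real^'d) \<times> real \<Rightarrow> complex) set"
  for S a b where
  const: "(\<lambda>p. c) \<in> kernel_alg S a b"
| flow_const: "(\<lambda>p. of_real (flow S (snd (snd p)) u $ i)) \<in> kernel_alg S a b"
| flow: "(\<lambda>p. of_real (flow S (snd (snd p)) (fst p) $ i)) \<in> kernel_alg S a b"
| target: "(\<lambda>p. of_real (fst (snd p) $ i)) \<in> kernel_alg S a b"
| inv_time: "(\<lambda>p. inverse (of_real (snd (snd p)))) \<in> kernel_alg S a b"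
| kernel: "(\<lambda>p. scalar_kernel S a b (fst p) (fst (snd p)) (snd (snd p))) \<in> kernel_alg S a b"
| add: "f \<in> kernel_alg S a b \<Longrightarrow> g \<in> kernel_alg S a b \<Longrightarrow> (\<lambda>p. f p + g p) \<in> kernel_alg S a b"
| mult: "f \<in> kernel_alg S a b \<Longrightarrow> g \<in> kernel_alg S a b \<Longrightarrow> (\<lambda>p. f p * g p) \<in> kernel_alg S a b"

lemma kernel_alg_diff:
  "f \<in> kernel_alg S a b \<Longrightarrow> g \<in> kernel_alg S a b \<Longrightarrow> (\<lambda>p. f p - g p) \<in> kernel_alg S a b"
  using kernel_alg.add[OF _ kernel_alg.mult[OF kernel_alg.const[of "-1"]]] by simp

lemma kernel_alg_sum:
  "(\<And>i. i \<in> I \<Longrightarrow> f i \<in> kernel_alg S a b) \<Longrightarrow> (\<lambda>p. \<Sum>i\<in>I. f i p) \<in> kernel_alg S a b"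
  by (induction I rule: infinite_finite_induct) (auto intro: kernel_alg.intros)

lemmas kernel_alg_intros = kernel_alg.intros kernel_alg_diff kernel_alg_sum

text \<open>The generators are what differentiation forces: the flow of \<open>x\<close> along
  \<open>u\<close> yields the flow of the fixed vector \<open>u\<close> (\<open>flow_const\<close>),
  time derivatives of flows yield combinations with entries of \<open>S\<close>, and the exponent
  and the power law yield powers of \<open>1 / t\<close>.\<close>

lemma kernel_alg_has_vector_derivative:
  fixes S :: "real^'d^'d" and e :: "(real^'d) \<times> (real^'d) \<times> real"
  assumes a: "Re a > 0" and "f \<in> kernel_alg S a b"
  shows "\<exists>g\<in>kernel_alg S a b. \<forall>p\<in>UNIV \<times> UNIV \<times> {0<..}.
    ((\<lambda>s. f (p + s *\<^sub>R e)) has_vector_derivative g p) (at 0)"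
  using assms(2)
proof induction
  let ?D = "\<lambda>f g. \<forall>p\<in>UNIV \<times> UNIV \<times> {0<..}. ((\<lambda>s. f (p + s *\<^sub>R e)) has_vector_derivative g p) (at 0)"
  obtain u v \<tau> where e: "e = (u, v, \<tau>)" by (metis prod.exhaust)
  have nth: "((\<lambda>s. complex_of_real (h s $ i)) has_vector_derivative of_real (h' $ i)) (at 0)"
    if "(h has_vector_derivative h') (at 0)" for h :: "real \<Rightarrow> real^'d" and h' i
    using bounded_linear.has_vector_derivative[OF bounded_linear_vec_nth that, of i]
    by (intro has_vector_derivative_of_real) (simp add: has_real_derivative_iff_has_vector_derivative)
  have S_nth: "of_real ((S *v w) $ i) = (\<Sum>j\<in>UNIV. of_real (S $ i $ j) * complex_of_real (w $ j))" for w i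
    by (simp add: matrix_vector_mult_def)
  {
    case (const c)
    show ?case by (rule bexI[OF _ kernel_alg.const[of 0]]) auto
  next
    case (flow_const c i)
    show ?case
    proof (rule bexI)
      show "?D (\<lambda>p. complex_of_real (flow S (snd (snd p)) c $ i))
        (\<lambda>p. of_real \<tau> * (\<Sum>j\<in>UNIV. of_real (S $ i $ j) * of_real (flow S (snd (snd p)) c $ j)))"
        using nth[OF flow_along_has_vector_derivative[where S = S and \<tau> = \<tau> and x = c and u = 0], of _ i]
        by (auto simp: e S_nth)
    qed (intro kernel_alg_intros)
  next
    case (flow i)
    show ?case
    proof (rule bexI)
      show "?D (\<lambda>p. complex_of_real (flow S (snd (snd p)) (fst p) $ i))
        (\<lambda>p. of_real (flow S (snd (snd p)) u $ i) +
          of_real \<tau> * (\<Sum>j\<in>UNIV. of_real (S $ i $ j) * of_real (flow S (snd (snd p)) (fst p) $ j)))"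
        using nth[OF flow_along_has_vector_derivative[where S = S and \<tau> = \<tau> and u = u], of _ _ i]
        by (auto simp: e S_nth)
    qed (intro kernel_alg_intros)
  next
    case (target i)
    have "((\<lambda>s. \<xi> + s *\<^sub>R v) has_vector_derivative v) (at 0)" for \<xi>
      by (auto intro!: derivative_eq_intros)
    from nth[OF this, of _ i] show ?case
      by (intro bexI[OF _ kernel_alg.const[of "of_real (v $ i)"]]) (auto simp: e)
  next
    case inv_time
    show ?case
    proof (rule bexI)
      show "?D (\<lambda>p. inverse (complex_of_real (snd (snd p))))
        (\<lambda>p. complex_of_real (- \<tau>) * (inverse (of_real (snd (snd p))) * inverse (of_real (snd (snd p)))))"
      proof
        fix p :: "(real^'d) \<times> (real^'d) \<times> real" assume "p \<in> UNIV \<times> UNIV \<times> {0<..}"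
        then have "snd (snd p) \<noteq> 0" by auto
        then have "((\<lambda>s. inverse (snd (snd p) + s * \<tau>)) has_real_derivative
            - \<tau> * (inverse (snd (snd p)) * inverse (snd (snd p)))) (at 0)"
          by (auto intro!: derivative_eq_intros)
        from has_vector_derivative_of_real[OF this, where ?'a = complex]
        show "((\<lambda>s. inverse (of_real (snd (snd (p + s *\<^sub>R e))))) has_vector_derivative
          complex_of_real (- \<tau>) * (inverse (of_real (snd (snd p))) * inverse (of_real (snd (snd p))))) (at 0)"
          by (simp add: e)
      qed
    qed (intro kernel_alg_intros)
  next
    case kernel
    \<comment> \<open>\<open>?g\<close> is the general derivative formula written in coordinates:
      inner products become sums and divisions by \<open>t\<close> become factors
      \<open>?t p\<close>, so membership follows from the closure rules.\<close>
    let ?w = "\<lambda>p i. complex_of_real (flow S (snd (snd p)) (fst p) $ i) - of_real (fst (snd p) $ i)"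
    let ?w' = "\<lambda>p i. complex_of_real (flow S (snd (snd p)) u $ i) + of_real \<tau> *
      (\<Sum>j\<in>UNIV. of_real (S $ i $ j) * of_real (flow S (snd (snd p)) (fst p) $ j)) - of_real (v $ i)"
    let ?t = "\<lambda>p. inverse (complex_of_real (snd (snd p)))"
    let ?g = "\<lambda>p. scalar_kernel S a b (fst p) (fst (snd p)) (snd (snd p)) *
      (of_real \<tau> * ((- (of_nat CARD('d) / 2) * ?t p - b) + (\<Sum>i\<in>UNIV. ?w p i * ?w p i) * (1 / (4 * a)) * (?t p * ?t p))
       - (\<Sum>i\<in>UNIV. ?w p i * ?w' p i) * (1 / (2 * a)) * ?t p)"
    show ?case
    proof (rule bexI)
      show "?D (\<lambda>p. scalar_kernel S a b (fst p) (fst (snd p)) (snd (snd p))) ?g"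
      proof
        fix p :: "(real^'d) \<times> (real^'d) \<times> real" assume "p \<in> UNIV \<times> UNIV \<times> {0<..}"
        then obtain x \<xi> t where p: "p = (x, \<xi>, t)" "t > 0" by auto
        define w where "w = flow S t x - \<xi>"
        define w' where "w' = flow S t u + \<tau> *\<^sub>R (S *v flow S t x) - v"
        have w_nth: "?w p i = of_real (w $ i)" and w'_nth: "?w' p i = of_real (w' $ i)" for i
          by (simp_all add: p w_def w'_def flip: S_nth)
        have sums: "(\<Sum>i\<in>UNIV. ?w p i * ?w p i) = of_real (w \<bullet> w)"
          "(\<Sum>i\<in>UNIV. ?w p i * ?w' p i) = of_real (w \<bullet> w')"
          unfolding w_nth w'_nth inner_vec_def inner_real_def of_real_sum of_real_mult
          by (rule refl)+
        have g: "?g p = scalar_kernel S a b x \<xi> t *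
            (of_real \<tau> * (- (of_nat CARD('d) / 2) / of_real t - b + of_real (w \<bullet> w) / (4 * a * of_real t * of_real t))
             - of_real (w \<bullet> w') / (2 * a * of_real t))"
          unfolding sums
          by (simp only: p fst_conv snd_conv divide_inverse inverse_mult_distrib mult_1_left mult.assoc)
        show "((\<lambda>s. scalar_kernel S a b (fst (p + s *\<^sub>R e)) (fst (snd (p + s *\<^sub>R e))) (snd (snd (p + s *\<^sub>R e))))
          has_vector_derivative ?g p) (at 0)"
          using scalar_kernel_along_has_vector_derivative[OF p(2) a, where S = S and b = b and x = x and u = u
              and \<xi> = \<xi> and v = v and \<tau> = \<tau>]
          unfolding g by (simp only: p e w_def w'_def fst_conv snd_conv scaleR_Pair add_Pair real_scaleR_def)
      qed
    qed (intro kernel_alg_intros)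
  next
    case (add f g)
    then obtain f' g' where "f' \<in> kernel_alg S a b" "?D f f'" "g' \<in> kernel_alg S a b" "?D g g'" by blast
    then show ?case
      by (intro bexI[of _ "\<lambda>p. f' p + g' p"]) (auto intro!: kernel_alg_intros has_vector_derivative_add)
  next
    case (mult f g)
    then obtain f' g' where f'g': "f' \<in> kernel_alg S a b" "?D f f'" "g' \<in> kernel_alg S a b" "?D g g'" by blast
    show ?case
    proof (rule bexI)
      show "?D (\<lambda>p. f p * g p) (\<lambda>p. f p * g' p + f' p * g p)"
      proof
        fix p :: "(real^'d) \<times> (real^'d) \<times> real" assume "p \<in> UNIV \<times> UNIV \<times> {0<..}"
        with f'g' have "((\<lambda>s. f (p + s *\<^sub>R e)) has_vector_derivative f' p) (at 0)"
          "((\<lambda>s. g (p + s *\<^sub>R e)) has_vector_derivative g' p) (at 0)" by blast+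
        from has_vector_derivative_mult[OF this]
        show "((\<lambda>s. f (p + s *\<^sub>R e) * g (p + s *\<^sub>R e)) has_vector_derivative f p * g' p + f' p * g p) (at 0)"
          by simp
      qed
    qed (use f'g' mult.hyps in \<open>intro kernel_alg_intros\<close>)
  }
qed

lemma continuous_on_flow [continuous_intros]:
  assumes "continuous_on X \<tau>" "continuous_on X f"
  shows "continuous_on X (\<lambda>p. flow S (\<tau> p) (f p))"
proof -
  have "continuous_on X (\<lambda>p. matrix_exp (\<tau> p *\<^sub>R S) $ i $ j)" for i j
  proof (rule continuous_on_compose2[OF _ assms(1)])
    show "continuous_on UNIV (\<lambda>t. matrix_exp (t *\<^sub>R S) $ i $ j)"
      by (rule DERIV_continuous_on) (rule matrix_exp_has_real_derivative[THEN has_field_derivative_at_within])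
  qed auto
  moreover have "continuous_on X (\<lambda>p. f p $ j)" for j
    by (intro continuous_intros assms)
  ultimately show ?thesis
    unfolding matrix_vector_mult_def
    by (intro continuous_on_vec_lambda continuous_on_sum continuous_on_mult)
qed

lemma continuous_on_kernel_alg:
  assumes a: "Re a > 0" and "f \<in> kernel_alg S a b"
  shows "continuous_on (UNIV \<times> UNIV \<times> {0<..}) f"
  using assms(2)
proof induction
  case kernel
  have [simp]: "a \<noteq> 0" using a by auto
  show ?case
    unfolding scalar_kernel_def using a
    by (intro continuous_intros) auto
qed (auto intro!: continuous_intros)

text \<open>Each recursive branch of \<open>C_klm\<close> lowers one index, hence induction on
  \<open>k + l + m\<close>. Agreement of \<open>f\<close> with a member of \<open>F\<close> is asked
  only for positive time, because the iterated \<open>partial\<close> is not controlled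
  elsewhere.\<close>

lemma C_klm_closed_class:
  fixes F :: "((real^'d) \<times> (real^'d) \<times> real \<Rightarrow> 'b::real_normed_vector) set"
  assumes cont: "\<And>f. f \<in> F \<Longrightarrow> continuous_on (UNIV \<times> UNIV \<times> {0<..}) f"
    and deriv: "\<And>f e. f \<in> F \<Longrightarrow> \<exists>g\<in>F. \<forall>p\<in>UNIV \<times> UNIV \<times> {0<..}.
      ((\<lambda>s. f (p + s *\<^sub>R e)) has_vector_derivative g p) (at 0)"
    and "g \<in> F" "\<And>p. p \<in> UNIV \<times> UNIV \<times> {0<..} \<Longrightarrow> f p = g p"
  shows "C_klm k l m f"
  using assms(3,4)
proof (induction "k + l + m" arbitrary: k l m f g rule: less_induct)
  case less
  let ?\<Omega> = "UNIV \<times> UNIV \<times> {0<..} :: ((real^'d) \<times> (real^'d) \<times> real) set"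
  have partials: "(\<forall>p\<in>?\<Omega>. has_partial e f p) \<and> (\<exists>h\<in>F. \<forall>p\<in>?\<Omega>. partial e f p = h p)" for e
  proof -
    obtain h where h: "h \<in> F" "\<And>p. p \<in> ?\<Omega> \<Longrightarrow> ((\<lambda>s. g (p + s *\<^sub>R e)) has_vector_derivative h p) (at 0)"
      using deriv[OF less.prems(1), of e] by blast
    \<comment> \<open>The domain is open, so for small \<open>s\<close> the line through
      \<open>p\<close> stays inside, where \<open>f\<close> and \<open>g\<close> agree.\<close>
    have f: "((\<lambda>s. f (p + s *\<^sub>R e)) has_vector_derivative h p) (at 0)" if "p \<in> ?\<Omega>" for p
    proof (rule has_vector_derivative_transform_within_open)
      have "open ?\<Omega>" by (intro open_Times) auto
      then show "open ((\<lambda>s. p + s *\<^sub>R e) -` ?\<Omega>)"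
        by (rule open_vimage) (intro continuous_intros)
    qed (use h(2)[OF that] that less.prems(2) in auto)
    then have "has_partial e f p" "partial e f p = h p" if "p \<in> ?\<Omega>" for p
      unfolding has_partial_def partial_def
      using that by (blast intro: differentiableI_vector vector_derivative_at)+
    with h(1) show ?thesis by blast
  qed
  have step: "C_klm k' l' m' (partial e f)" if "k' + l' + m' < k + l + m" for k' l' m' e
    using partials[of e] less.hyps[OF that] by blast
  have "continuous_on ?\<Omega> f"
    using cont[OF less.prems(1)] less.prems(2) by (simp cong: continuous_on_cong)
  then show ?case
    by (subst C_klm.simps) (use partials in \<open>auto intro!: step\<close>)
qed

text \<open>The closed class consists of spectral sums whose coefficient \<open>k\<close> lies in
  its own algebra, with parameters \<open>a k\<close> and \<open>b k\<close>.\<close>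

lemma C_klm_spectral_sum:
  fixes Y :: "complex^'n^'n" and S :: "real^'d^'d"
  assumes a: "\<And>k. Re (a k) > 0"
    and f: "\<And>x \<xi> t. t > 0 \<Longrightarrow> f (x, \<xi>, t) = (\<Sum>k\<in>UNIV. spectral_proj Y k (scalar_kernel S (a k) (b k) x \<xi> t))"
  shows "C_klm k l m f"
proof -
  define F where "F = {\<lambda>p. \<Sum>k\<in>UNIV. spectral_proj Y k (g k p) | g. \<forall>k. g k \<in> kernel_alg S (a k) (b k)}"
  let ?h = "\<lambda>k p. scalar_kernel S (a k) (b k) (fst p) (fst (snd p)) (snd (snd p))"
  show ?thesis
  proof (rule C_klm_closed_class[where F = F and g = "\<lambda>p. \<Sum>k\<in>UNIV. spectral_proj Y k (?h k p)"])
    fix f assume "f \<in> F"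
    then obtain g where g: "\<And>k. g k \<in> kernel_alg S (a k) (b k)"
      and f: "f = (\<lambda>p. \<Sum>k\<in>UNIV. spectral_proj Y k (g k p))"
      unfolding F_def by blast
    show "continuous_on (UNIV \<times> UNIV \<times> {0<..}) f"
      unfolding f
      by (intro continuous_on_sum bounded_linear.continuous_on[OF bounded_linear_spectral_proj]
          continuous_on_kernel_alg[OF a g])
    fix e
    have "\<forall>k. \<exists>g'. g' \<in> kernel_alg S (a k) (b k) \<and> (\<forall>p\<in>UNIV \<times> UNIV \<times> {0<..}.
        ((\<lambda>s. g k (p + s *\<^sub>R e)) has_vector_derivative g' p) (at 0))"
      using kernel_alg_has_vector_derivative[OF a g] by blast
    then obtain g' where g': "\<And>k. g' k \<in> kernel_alg S (a k) (b k)"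
      "\<And>k p. p \<in> UNIV \<times> UNIV \<times> {0<..} \<Longrightarrow> ((\<lambda>s. g k (p + s *\<^sub>R e)) has_vector_derivative g' k p) (at 0)"
      by metis
    show "\<exists>g\<in>F. \<forall>p\<in>UNIV \<times> UNIV \<times> {0<..}. ((\<lambda>s. f (p + s *\<^sub>R e)) has_vector_derivative g p) (at 0)"
    proof (intro bexI ballI)
      show "(\<lambda>p. \<Sum>k\<in>UNIV. spectral_proj Y k (g' k p)) \<in> F"
        unfolding F_def using g'(1) by blast
      fix p :: "(real^'d) \<times> (real^'d) \<times> real" assume "p \<in> UNIV \<times> UNIV \<times> {0<..}"
      then show "((\<lambda>s. f (p + s *\<^sub>R e)) has_vector_derivative (\<Sum>k\<in>UNIV. spectral_proj Y k (g' k p))) (at 0)"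
        unfolding f
        by (intro has_vector_derivative_sum
            bounded_linear.has_vector_derivative[OF bounded_linear_spectral_proj] g'(2))
    qed
  next
    show "(\<lambda>p. \<Sum>k\<in>UNIV. spectral_proj Y k (?h k p)) \<in> F"
      unfolding F_def by (intro CollectI exI[of _ ?h] conjI refl allI kernel_alg.kernel)
  qed (use f in auto)
qed

section \<open>The differential equation\<close>

text \<open>\<open>space_rate S a x \<xi> t u\<close> is the logarithmic derivative of the scalar kernel in \<open>x\<close> along \<open>u\<close>.\<close>

definition space_rate :: "real^'d^'d \<Rightarrow> complex \<Rightarrow> real^'d \<Rightarrow> real^'d \<Rightarrow> real \<Rightarrow> real^'d \<Rightarrow> complex" where
  "space_rate S a x \<xi> t u = - of_real ((flow S t x - \<xi>) \<bullet> flow S t u) / (2 * a * of_real t)"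

lemma scalar_kernel_space_derivative:
  assumes "t > 0" "Re a > 0"
  shows "((\<lambda>s. scalar_kernel S a b (x + s *\<^sub>R u) \<xi> t) has_vector_derivative
    scalar_kernel S a b x \<xi> t * space_rate S a x \<xi> t u) (at 0)"
  using scalar_kernel_along_has_vector_derivative[OF assms, where S = S and b = b and x = x and u = u
      and \<xi> = \<xi> and v = 0 and \<tau> = 0]
  by (simp add: space_rate_def)

text \<open>Along \<open>u\<close> the rate is affine in \<open>s\<close>, and its slope involves
  the squared norm of \<open>flow S t u\<close>, which equals that of \<open>u\<close> by isometry.
  The product rule does the rest.\<close>

lemma scalar_kernel_space_derivative2:
  fixes S :: "real^'d^'d"
  assumes t: "t > 0" and a: "Re a > 0" and S: "transpose S = - S"
  shows "((\<lambda>s. scalar_kernel S a b (x + s *\<^sub>R u) \<xi> t * space_rate S a (x + s *\<^sub>R u) \<xi> t u)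
    has_vector_derivative scalar_kernel S a b x \<xi> t *
      ((space_rate S a x \<xi> t u)\<^sup>2 - of_real ((norm u)\<^sup>2) / (2 * a * of_real t))) (at 0)"
proof -
  let ?r = "\<lambda>s. (flow S t (x + s *\<^sub>R u) - \<xi>) \<bullet> flow S t u"
  have "?r = (\<lambda>s. (flow S t x - \<xi>) \<bullet> flow S t u + s * (norm u)\<^sup>2)"
    using norm_matrix_exp_skew[OF S, of t u]
    by (simp add: fun_eq_iff matrix_vector_right_distrib matrix_vector_mult_scaleR inner_diff_left
        inner_add_left dot_square_norm)
  then have "(?r has_real_derivative (norm u)\<^sup>2) (at 0)"
    by (auto intro!: derivative_eq_intros)
  from has_vector_derivative_of_real[OF this, where ?'a = complex]
  have "((\<lambda>s. space_rate S a (x + s *\<^sub>R u) \<xi> t u) has_vector_derivative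
      - of_real ((norm u)\<^sup>2) / (2 * a * of_real t)) (at 0)"
    unfolding space_rate_def
    by (intro has_vector_derivative_divide has_vector_derivative_minus)
  from has_vector_derivative_mult[OF scalar_kernel_space_derivative[OF t a] this]
  show ?thesis
    by (simp add: power2_eq_square right_diff_distrib mult.assoc)
qed

text \<open>The inner products of \<open>w\<close> with the columns of the exponential are the
  coordinates of its transpose applied to \<open>w\<close>, and that transpose is again an
  isometry.\<close>

lemma sum_space_rate_squared:
  fixes S :: "real^'d^'d"
  assumes S: "transpose S = - S"
  shows "(\<Sum>i\<in>UNIV. (space_rate S a x \<xi> t (axis i 1))\<^sup>2)
    = of_real ((norm (flow S t x - \<xi>))\<^sup>2) / (2 * a * of_real t)\<^sup>2"
proof -
  define E where "E = matrix_exp (t *\<^sub>R S)"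
  define w where "w = flow S t x - \<xi>"
  have "w \<bullet> (E *v axis i 1) = (transpose E *v w) $ i" for i
    by (metis dot_lmul_matrix inner_axis' inner_commute mult_1 real_inner_1_right transpose_matrix_vector
        inner_axis inner_real_def mult.right_neutral)
  moreover have "(\<Sum>i\<in>UNIV. ((transpose E *v w) $ i)\<^sup>2) = (norm (transpose E *v w))\<^sup>2"
    by (simp add: norm_vec_def L2_set_def sum_nonneg)
  moreover have "norm (transpose E *v w) = norm w"
  proof -
    have "(transpose E *v w) \<bullet> (transpose E *v w) = w \<bullet> ((E ** transpose E) *v w)"
      by (metis dot_lmul_matrix matrix_vector_mul_assoc transpose_matrix_vector)
    then show ?thesis
      using orthogonal_matrix_exp_skew[OF S, of t]
      by (simp add: orthogonal_matrix_def E_def norm_eq_sqrt_inner)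
  qed
  ultimately have "(\<Sum>i\<in>UNIV. (w \<bullet> (E *v axis i 1))\<^sup>2) = (norm w)\<^sup>2"
    by simp
  then have "(\<Sum>i\<in>UNIV. complex_of_real ((w \<bullet> (E *v axis i 1))\<^sup>2)) = of_real ((norm w)\<^sup>2)"
    by (simp only: of_real_sum[symmetric])
  then show ?thesis
    unfolding space_rate_def power_divide power2_minus w_def[symmetric] unfolding E_def[symmetric]
    by (simp only: of_real_power[symmetric] sum_divide_distrib[symmetric])
qed

text \<open>The rate is linear in its direction, so contracting the gradient with
  \<open>S *v x\<close> gives one directional rate.\<close>

lemma sum_drift_space_rate:
  fixes S :: "real^'d^'d"
  shows "(\<Sum>i\<in>UNIV. of_real ((S *v x) $ i) * space_rate S a x \<xi> t (axis i 1))
    = space_rate S a x \<xi> t (S *v x)"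
proof -
  have "(\<Sum>i\<in>UNIV. (S *v x) $ i *\<^sub>R flow S t (axis i 1)) = flow S t (S *v x)"
  proof -
    have "S *v x = (\<Sum>i\<in>UNIV. (S *v x) $ i *\<^sub>R axis i 1)"
      using basis_expansion[of "S *v x"] by (simp add: scalar_mult_eq_scaleR)
    then have "flow S t (S *v x) = flow S t (\<Sum>i\<in>UNIV. (S *v x) $ i *\<^sub>R axis i 1)"
      by (rule arg_cong)
    then show ?thesis
      by (simp add: linear_sum[OF matrix_vector_mul_linear] matrix_vector_mult_scaleR)
  qed
  then have "(flow S t x - \<xi>) \<bullet> flow S t (S *v x)
      = (\<Sum>i\<in>UNIV. (S *v x) $ i * ((flow S t x - \<xi>) \<bullet> flow S t (axis i 1)))"
    by (metis (no_types, lifting) inner_scaleR_right inner_sum_right sum.cong)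
  then show ?thesis
    unfolding space_rate_def by (simp add: sum_divide_distrib sum_negf)
qed

text \<open>The right side is the operator with \<open>A\<close>, \<open>B\<close> replaced by
  \<open>a\<close>, \<open>b\<close>, written out for the scalar kernel. Diffusion accounts for the
  power law and for \<open>1 / t\<close> in the exponent, drift for the moving centre.\<close>

lemma scalar_kernel_time_derivative:
  fixes S :: "real^'d^'d" and x \<xi> :: "real^'d" and a b :: complex and t :: real
  assumes t: "t > 0" and a: "Re a > 0" and S: "transpose S = - S"
  defines "K \<equiv> scalar_kernel S a b x \<xi>" and "r \<equiv> space_rate S a x \<xi> t"
  shows "(K has_vector_derivative
      a * (\<Sum>i\<in>UNIV. K t * ((r (axis i 1))\<^sup>2 - 1 / (2 * a * of_real t)))
      + (\<Sum>i\<in>UNIV. of_real ((S *v x) $ i) * (K t * r (axis i 1))) - b * K t) (at t)"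
proof -
  have nz: "a \<noteq> 0" "complex_of_real t \<noteq> 0" using t a by auto
  let ?w = "flow S t x - \<xi>"
  have D: "((\<lambda>s. K (t + s)) has_vector_derivative
      K t * (- (of_nat CARD('d) / 2) / of_real t - b + of_real (?w \<bullet> ?w) / (4 * a * of_real t * of_real t)
       - of_real (?w \<bullet> (S *v flow S t x)) / (2 * a * of_real t))) (at 0)"
    using scalar_kernel_along_has_vector_derivative[OF t a, where S = S and b = b and x = x and u = 0
      and \<xi> = \<xi> and v = 0 and \<tau> = 1]
    by (simp add: K_def)
  \<comment> \<open>The velocity term of the flow is the drift rate, since \<open>S\<close> commutes
    with its exponential.\<close>
  have rS: "- (of_real (?w \<bullet> (S *v flow S t x)) / (2 * a * of_real t)) = r (S *v x)"
    unfolding r_def space_rate_def minus_divide_left matrix_vector_mul_assoc matrix_exp_commute ..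
  have rearrange: "k * (p - b + q - z) = k * (p + q) + k * (- z) - b * k" for k p q z :: complex
    by (simp add: algebra_simps)
  have sq: "(\<Sum>i\<in>UNIV. (r (axis i 1))\<^sup>2) = of_real (?w \<bullet> ?w) / (2 * a * of_real t)\<^sup>2"
    unfolding r_def sum_space_rate_squared[OF S] dot_square_norm ..
  have "a * (\<Sum>i\<in>UNIV. K t * ((r (axis i 1))\<^sup>2 - 1 / (2 * a * of_real t)))
      = K t * (a * ((\<Sum>i\<in>UNIV. (r (axis i 1))\<^sup>2) - of_nat CARD('d) * (1 / (2 * a * of_real t))))"
    by (simp only: sum_distrib_left[symmetric] sum_subtractf sum_constant mult.left_commute)
  also have "a * ((\<Sum>i\<in>UNIV. (r (axis i 1))\<^sup>2) - of_nat CARD('d) * (1 / (2 * a * of_real t)))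
      = - (of_nat CARD('d) / 2) / of_real t + of_real (?w \<bullet> ?w) / (4 * a * of_real t * of_real t)"
    unfolding sq using nz by (simp add: field_simps power2_eq_square)
  finally have lap: "a * (\<Sum>i\<in>UNIV. K t * ((r (axis i 1))\<^sup>2 - 1 / (2 * a * of_real t))) = K t * \<dots>" .
  have drift: "(\<Sum>i\<in>UNIV. of_real ((S *v x) $ i) * (K t * r (axis i 1))) = K t * r (S *v x)"
    unfolding r_def sum_drift_space_rate[symmetric] sum_distrib_left by (simp only: mult.left_commute)
  have "((\<lambda>s. K (t + s)) has_vector_derivative
      a * (\<Sum>i\<in>UNIV. K t * ((r (axis i 1))\<^sup>2 - 1 / (2 * a * of_real t)))
      + (\<Sum>i\<in>UNIV. of_real ((S *v x) $ i) * (K t * r (axis i 1))) - b * K t) (at 0)"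
    using D unfolding rearrange rS lap drift .
  moreover have "((\<lambda>s. s - t) has_vector_derivative 1) (at t)"
    by (auto intro!: derivative_eq_intros)
  ultimately show ?thesis
    using vector_diff_chain_at[of "\<lambda>s. s - t" 1 t "\<lambda>s. K (t + s)"] by (simp add: o_def)
qed

section \<open>From the scalar equations to the matrix equation\<close>

lemma column_matrix_mult: "A *v column j M = column j (A ** M)"
  by (simp add: vec_eq_iff column_def matrix_vector_mult_def matrix_matrix_mult_def)

lemma diag_conj_mult_spectral_proj:
  assumes "invertible Y"
  shows "(Y ** diag_matrix a ** matrix_inv Y) ** spectral_proj Y k z = spectral_proj Y k (a k * z)"
  unfolding spectral_proj_def diag_conj_mult[OF assms]
  by (rule arg_cong[where f = "\<lambda>l. Y ** diag_matrix l ** matrix_inv Y"]) auto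

lemma partial_eqI: "((\<lambda>s. f (p + s *\<^sub>R e)) has_vector_derivative D) (at 0) \<Longrightarrow> partial e f p = D"
  unfolding partial_def by (rule vector_derivative_at)

text \<open>On the \<open>k\<close>-th spectral component \<open>A\<close> and \<open>B\<close>
  multiply the scalar by \<open>a k\<close> and \<open>b k\<close>, so the operator decouples into
  the scalar ones.\<close>

lemma spectral_sum_satisfies_pde:
  fixes Y :: "complex^'n^'n" and S :: "real^'d^'d" and \<xi> :: "real^'d" and b :: "'n \<Rightarrow> complex" and j :: 'n
  assumes Y: "invertible Y" and a: "\<And>k. Re (a k) > 0" and S: "transpose S = - S" and t: "t > 0"
    and A: "A = Y ** diag_matrix a ** matrix_inv Y" and B: "B = Y ** diag_matrix b ** matrix_inv Y"
  defines "v \<equiv> \<lambda>x t. column j (\<Sum>k\<in>UNIV. spectral_proj Y k (scalar_kernel S (a k) (b k) x \<xi> t))"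
  shows "(v x has_vector_derivative L_inf A B S (\<lambda>y. v y t) x) (at t)"
proof -
  define c where "c k z = column j (spectral_proj Y k z)" for k z
  let ?K = "\<lambda>k. scalar_kernel S (a k) (b k)" and ?r = "\<lambda>k x. space_rate S (a k) x \<xi> t"
  have c: "bounded_linear (c k)" for k
  proof -
    have "linear (c k)"
      unfolding c_def by (rule linearI) (simp_all add: vec_eq_iff column_def spectral_proj_nth algebra_simps)
    then show ?thesis by (simp add: linear_conv_bounded_linear)
  qed
  note c_simps = linear_sum[OF bounded_linear.linear[OF c]] linear_add[OF bounded_linear.linear[OF c]]
    linear_diff[OF bounded_linear.linear[OF c]]
  have v: "v y s = (\<Sum>k\<in>UNIV. c k (?K k y \<xi> s))" for y s
    by (simp add: v_def c_def column_def vec_eq_iff)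
  have Ac: "A *v (\<Sum>k\<in>UNIV. c k (z k)) = (\<Sum>k\<in>UNIV. c k (a k * z k))" for z
    by (simp add: linear_sum[OF matrix_vector_mul_linear] c_def column_matrix_mult A
        diag_conj_mult_spectral_proj[OF Y])
  have Bc: "B *v (\<Sum>k\<in>UNIV. c k (z k)) = (\<Sum>k\<in>UNIV. c k (b k * z k))" for z
    by (simp add: linear_sum[OF matrix_vector_mul_linear] c_def column_matrix_mult B
        diag_conj_mult_spectral_proj[OF Y])
  \<comment> \<open>An equation between functions, because \<open>laplacian\<close> differentiates
    the result again.\<close>
  have d1: "partial (axis i 1) (\<lambda>y. v y t) = (\<lambda>y. \<Sum>k\<in>UNIV. c k (?K k y \<xi> t * ?r k y (axis i 1)))" for i
    unfolding v
    by (intro ext partial_eqI has_vector_derivative_sum bounded_linear.has_vector_derivative[OF c]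
        scalar_kernel_space_derivative t a)
  have d2: "partial (axis i 1) (\<lambda>y. \<Sum>k\<in>UNIV. c k (?K k y \<xi> t * ?r k y (axis i 1))) x
      = (\<Sum>k\<in>UNIV. c k (?K k x \<xi> t * ((?r k x (axis i 1))\<^sup>2 - 1 / (2 * a k * of_real t))))" for i
  proof -
    have "complex_of_real ((norm (axis i 1 :: real^'d))\<^sup>2) = 1"
      by (simp add: power2_norm_eq_inner inner_axis_axis)
    from scalar_kernel_space_derivative2[OF t a S, where u = "axis i 1" and ?x = x and \<xi> = \<xi>, unfolded this]
    show ?thesis
      by (intro partial_eqI has_vector_derivative_sum bounded_linear.has_vector_derivative[OF c])
  qed
  have lap: "laplacian (\<lambda>y. v y t) x = (\<Sum>k\<in>UNIV. c k
      (\<Sum>i\<in>UNIV. ?K k x \<xi> t * ((?r k x (axis i 1))\<^sup>2 - 1 / (2 * a k * of_real t))))"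
    unfolding laplacian_def d1 d2 c_simps by (rule sum.swap)
  have c_scaleR: "r *\<^sub>R c k z = c k (of_real r * z)" for r k z
    using linear_scale[OF bounded_linear.linear[OF c[of k]]] by (simp add: scaleR_conv_of_real)
  have drift: "(\<Sum>i\<in>UNIV. (S *v x) $ i *\<^sub>R partial (axis i 1) (\<lambda>y. v y t) x)
      = (\<Sum>k\<in>UNIV. c k (\<Sum>i\<in>UNIV. of_real ((S *v x) $ i) * (?K k x \<xi> t * ?r k x (axis i 1))))"
    unfolding d1 scaleR_sum_right c_scaleR c_simps by (rule sum.swap)
  have L: "L_inf A B S (\<lambda>y. v y t) x = (\<Sum>k\<in>UNIV. c k
      (a k * (\<Sum>i\<in>UNIV. ?K k x \<xi> t * ((?r k x (axis i 1))\<^sup>2 - 1 / (2 * a k * of_real t)))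
      + (\<Sum>i\<in>UNIV. of_real ((S *v x) $ i) * (?K k x \<xi> t * ?r k x (axis i 1))) - b k * ?K k x \<xi> t))"
    unfolding L_inf_def lap drift Ac unfolding v Bc
    by (simp only: c_simps sum.distrib sum_subtractf)
  have "((\<lambda>s. v x s) has_vector_derivative (\<Sum>k\<in>UNIV. c k
      (a k * (\<Sum>i\<in>UNIV. ?K k x \<xi> t * ((?r k x (axis i 1))\<^sup>2 - 1 / (2 * a k * of_real t)))
      + (\<Sum>i\<in>UNIV. of_real ((S *v x) $ i) * (?K k x \<xi> t * ?r k x (axis i 1))) - b k * ?K k x \<xi> t))) (at t)"
    unfolding v
    by (intro has_vector_derivative_sum bounded_linear.has_vector_derivative[OF c]
        scalar_kernel_time_derivative t a S)
  then show ?thesis unfolding L .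
qed

section \<open>The initial condition\<close>

lemma has_bochner_integral_lborel_affine:
  fixes f :: "'a::euclidean_space \<Rightarrow> 'b::{banach, second_countable_topology}"
  assumes c: "c \<noteq> 0" and f: "f \<in> borel_measurable borel"
    and I: "has_bochner_integral lborel (\<lambda>y. f (p + c *\<^sub>R y)) I"
  shows "has_bochner_integral lborel f (\<bar>c\<bar> ^ DIM('a) *\<^sub>R I)"
proof -
  have "has_bochner_integral (distr lborel borel (\<lambda>x. p + c *\<^sub>R x))
      (\<lambda>x. \<bar>c\<bar> ^ DIM('a) *\<^sub>R f x) (\<bar>c\<bar> ^ DIM('a) *\<^sub>R I)"
    using f I by (subst has_bochner_integral_distr) (auto intro!: has_bochner_integral_scaleR_right)
  then have "has_bochner_integral (density (distr lborel borel (\<lambda>x. p + c *\<^sub>R x)) (\<lambda>_. \<bar>c\<bar> ^ DIM('a)))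
      f (\<bar>c\<bar> ^ DIM('a) *\<^sub>R I)"
    using f by (intro has_bochner_integral_density) auto
  then show ?thesis
    by (subst lborel_affine[OF c, of p])
qed

lemma gaussian_mult_integrable:
  fixes f :: "'a::euclidean_space \<Rightarrow> complex"
  assumes z: "Re z > 0" and f: "continuous_on UNIV f" and C: "\<And>y. norm (f y) \<le> C"
  shows "integrable lborel (\<lambda>y. exp (- z * of_real ((norm y)\<^sup>2)) * f y)"
proof (rule Bochner_Integration.integrable_bound)
  show "integrable lborel (\<lambda>y::'a. C * norm (exp (- z * of_real ((norm y)\<^sup>2))))"
    using has_bochner_integral_complex_gaussian_euclidean[OF z, where 'a = 'a]
    by (intro integrable_mult_right integrable_norm) (rule integrable.intros)
  have "continuous_on UNIV (\<lambda>y. exp (- z * of_real ((norm y)\<^sup>2)) * f y)"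
    by (intro continuous_intros f)
  then show "(\<lambda>y. exp (- z * of_real ((norm y)\<^sup>2)) * f y) \<in> borel_measurable lborel"
    by (simp add: borel_measurable_continuous_onI)
  have "C \<ge> 0" using C norm_ge_zero order_trans by blast
  then have "norm (e * f y) \<le> norm (C * norm e)" for e y
    using mult_right_mono[OF C norm_ge_zero, of y e] by (simp add: norm_mult abs_mult mult.commute)
  then show "AE y in lborel. norm (exp (- z * of_real ((norm y)\<^sup>2)) * f y)
      \<le> norm (C * norm (exp (- z * of_real ((norm y)\<^sup>2))))"
    by (intro AE_I2)
qed

text \<open>Rescaling by \<open>sqrt t\<close> removes \<open>t\<close> from the quadratic exponent,
  and the Jacobian cancels the power of \<open>t\<close> in the normalization. Time survives only in
  the factor with \<open>b\<close> and in the argument of \<open>\<phi>\<close>.\<close>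

lemma scalar_kernel_integral:
  fixes S :: "real^'d^'d" and \<phi> :: "real^'d \<Rightarrow> complex"
  assumes t: "t > 0" and a: "Re a > 0" and \<phi>: "continuous_on UNIV \<phi>" and C: "\<And>y. norm (\<phi> y) \<le> C"
  shows "has_bochner_integral lborel (\<lambda>\<xi>. scalar_kernel S a b x \<xi> t * \<phi> \<xi>)
    (exp (- (of_real t * b)) * (4 * of_real pi * a) powr (- (of_nat CARD('d) / 2)) *
     (LINT y|lborel. exp (- (1 / (4 * a)) * of_real ((norm y)\<^sup>2)) * \<phi> (flow S t x + sqrt t *\<^sub>R y)))"
proof -
  let ?p = "- (of_nat CARD('d) / 2) :: complex" and ?z = "1 / (4 * a)"
  let ?G = "\<lambda>y. exp (- ?z * of_real ((norm y)\<^sup>2)) * \<phi> (flow S t x + sqrt t *\<^sub>R y)"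
  have z: "Re ?z > 0" using a by (simp add: Re_divide add_pos_nonneg)
  have nz: "a \<noteq> 0" "complex_of_real t \<noteq> 0" using t a by auto
  have "(4 * of_real pi * of_real t * a) powr ?p = (of_real t * (4 * of_real pi * a)) powr ?p"
    by (simp only: mult_ac)
  also have "\<dots> = of_real t powr ?p * (4 * of_real pi * a) powr ?p"
    using t by (subst powr_times_real_left) auto
  also have "of_real t powr ?p = of_real (t powr (- (real CARD('d) / 2)))"
    using powr_of_real[of t "- (real CARD('d) / 2)"] t by simp
  also have "t powr (- (real CARD('d) / 2)) = inverse (sqrt t ^ CARD('d))"
    using t by (simp add: powr_minus powr_half_sqrt[symmetric] powr_power)
  finally have factor: "sqrt t ^ CARD('d) *\<^sub>R (4 * of_real pi * of_real t * a) powr ?p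
      = (4 * of_real pi * a) powr ?p"
    using t by (simp add: scaleR_conv_of_real)
  have K: "scalar_kernel S a b x (flow S t x + sqrt t *\<^sub>R y) t * \<phi> (flow S t x + sqrt t *\<^sub>R y)
      = exp (- (of_real t * b)) * (4 * of_real pi * of_real t * a) powr ?p * ?G y" for y
  proof -
    have "of_real ((norm (flow S t x - (flow S t x + sqrt t *\<^sub>R y)))\<^sup>2) / (4 * of_real t * a)
        = ?z * of_real ((norm y)\<^sup>2)"
      using t nz by (simp add: power_mult_distrib)
    then have "exp (- (of_real t * b) - of_real ((norm (flow S t x - (flow S t x + sqrt t *\<^sub>R y)))\<^sup>2) / (4 * of_real t * a))
        = exp (- (of_real t * b)) * exp (- ?z * of_real ((norm y)\<^sup>2))"
      by (simp only: exp_diff exp_minus divide_inverse mult_minus_left)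
    then show ?thesis
      unfolding scalar_kernel_def by (simp only: mult_ac)
  qed
  have "has_bochner_integral lborel ?G (LINT y|lborel. ?G y)"
    by (intro has_bochner_integral_integrable gaussian_mult_integrable[where C = C] z continuous_intros C
        continuous_on_compose2[OF \<phi>]) auto
  then have "has_bochner_integral lborel
      (\<lambda>y. scalar_kernel S a b x (flow S t x + sqrt t *\<^sub>R y) t * \<phi> (flow S t x + sqrt t *\<^sub>R y))
      (exp (- (of_real t * b)) * (4 * of_real pi * of_real t * a) powr ?p * (LINT y|lborel. ?G y))"
    unfolding K by (rule has_bochner_integral_mult_right)
  moreover have "continuous_on UNIV (\<lambda>\<xi>. scalar_kernel S a b x \<xi> t * \<phi> \<xi>)"
    unfolding scalar_kernel_def using nz by (intro continuous_intros \<phi>) auto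
  ultimately have "has_bochner_integral lborel (\<lambda>\<xi>. scalar_kernel S a b x \<xi> t * \<phi> \<xi>)
      (\<bar>sqrt t\<bar> ^ DIM(real^'d) *\<^sub>R
       (exp (- (of_real t * b)) * (4 * of_real pi * of_real t * a) powr ?p * (LINT y|lborel. ?G y)))"
    using t by (intro has_bochner_integral_lborel_affine borel_measurable_continuous_onI) auto
  also have "\<bar>sqrt t\<bar> ^ DIM(real^'d) *\<^sub>R
       (exp (- (of_real t * b)) * (4 * of_real pi * of_real t * a) powr ?p * (LINT y|lborel. ?G y))
     = exp (- (of_real t * b)) * (sqrt t ^ CARD('d) *\<^sub>R (4 * of_real pi * of_real t * a) powr ?p) *
       (LINT y|lborel. ?G y)"
    using t by simp
  finally show ?thesis
    unfolding factor .
qed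

lemma gaussian_average_tendsto:
  fixes \<phi> :: "'a::euclidean_space \<Rightarrow> complex" and z :: complex
  assumes z: "Re z > 0" and \<phi>: "continuous_on UNIV \<phi>" and C: "\<And>y. norm (\<phi> y) \<le> C"
    and q: "(q \<longlongrightarrow> x) (at_right 0)"
  shows "((\<lambda>t. LINT y|lborel. exp (- z * of_real ((norm y)\<^sup>2)) * \<phi> (q t + sqrt t *\<^sub>R y)) \<longlongrightarrow>
    (pi / z) powr (of_nat DIM('a) / 2) * \<phi> x) (at_right 0)"
proof -
  let ?g = "\<lambda>y::'a. exp (- z * of_real ((norm y)\<^sup>2))"
  have g: "has_bochner_integral lborel ?g ((pi / z) powr (of_nat DIM('a) / 2))"
    using z by (rule has_bochner_integral_complex_gaussian_euclidean)
  have meas: "(\<lambda>y. ?g y * \<phi> (v + r *\<^sub>R y)) \<in> borel_measurable lborel" for v r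
  proof -
    have "continuous_on UNIV (\<lambda>y. ?g y * \<phi> (v + r *\<^sub>R y))"
      by (intro continuous_intros continuous_on_compose2[OF \<phi>]) auto
    then show ?thesis by (simp add: borel_measurable_continuous_onI)
  qed
  \<comment> \<open>Time is inverted so that dominated convergence along \<open>at_top\<close>
    applies. The majorant \<open>C * norm (?g y)\<close> is independent of time.\<close>
  have "((\<lambda>t. LINT y|lborel. ?g y * \<phi> (q (inverse t) + sqrt (inverse t) *\<^sub>R y)) \<longlongrightarrow>
      (LINT y|lborel. ?g y * \<phi> x)) at_top"
  proof (rule integral_dominated_convergence_at_top[where w = "\<lambda>y. C * norm (?g y)"])
    show "integrable lborel (\<lambda>y. C * norm (?g y))"
      using integrable.intros[OF g] by (intro integrable_mult_right integrable_norm)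
    show "(\<lambda>y. ?g y * \<phi> x) \<in> borel_measurable lborel"
      using meas[of x 0] by simp
    show "(\<lambda>y. ?g y * \<phi> (q (inverse t) + sqrt (inverse t) *\<^sub>R y)) \<in> borel_measurable lborel" for t
      by (rule meas)
    have "norm (e * \<phi> y) \<le> C * norm e" for e y
      using mult_right_mono[OF C norm_ge_zero, of y e] by (simp add: norm_mult mult.commute)
    then show "\<forall>\<^sub>F t in at_top. AE y in lborel. norm (?g y * \<phi> (q (inverse t) + sqrt (inverse t) *\<^sub>R y)) \<le> C * norm (?g y)"
      by (intro always_eventually allI AE_I2)
    show "AE y in lborel. ((\<lambda>t. ?g y * \<phi> (q (inverse t) + sqrt (inverse t) *\<^sub>R y)) \<longlongrightarrow> ?g y * \<phi> x) at_top"
    proof (intro AE_I2 tendsto_mult tendsto_const)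
      fix y :: 'a
      have "((\<lambda>t. q t + sqrt t *\<^sub>R y) \<longlongrightarrow> x + sqrt 0 *\<^sub>R y) (at_right 0)"
        by (intro tendsto_add q tendsto_scaleR tendsto_real_sqrt tendsto_const tendsto_ident_at)
      then have "((\<lambda>t. q (inverse t) + sqrt (inverse t) *\<^sub>R y) \<longlongrightarrow> x) at_top"
        by (simp add: filterlim_at_right_to_top)
      then show "((\<lambda>t. \<phi> (q (inverse t) + sqrt (inverse t) *\<^sub>R y)) \<longlongrightarrow> \<phi> x) at_top"
        by (rule continuous_on_tendsto_compose[OF \<phi>]) auto
    qed
  qed
  then have "((\<lambda>t. LINT y|lborel. ?g y * \<phi> (q t + sqrt t *\<^sub>R y)) \<longlongrightarrow> (LINT y|lborel. ?g y * \<phi> x)) (at_right 0)"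
    by (simp only: filterlim_at_right_to_top)
  also have "(LINT y|lborel. ?g y * \<phi> x) = (pi / z) powr (of_nat DIM('a) / 2) * \<phi> x"
    using has_bochner_integral_mult_left[OF g] by (rule has_bochner_integral_integral_eq)
  finally show ?thesis .
qed

lemma scalar_kernel_integral_tendsto:
  fixes S :: "real^'d^'d" and \<phi> :: "real^'d \<Rightarrow> complex"
  assumes a: "Re a > 0" and \<phi>: "continuous_on UNIV \<phi>" and C: "\<And>y. norm (\<phi> y) \<le> C"
  shows "((\<lambda>t. LINT \<xi>|lborel. scalar_kernel S a b x \<xi> t * \<phi> \<xi>) \<longlongrightarrow> \<phi> x) (at_right 0)"
proof -
  let ?p = "of_nat CARD('d) / 2 :: complex" and ?z = "1 / (4 * a)"
  have z: "Re ?z > 0" using a by (simp add: Re_divide add_pos_nonneg)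
  have "continuous_on UNIV (\<lambda>t. flow S t x)"
    by (intro continuous_intros)
  then have q: "((\<lambda>t. flow S t x) \<longlongrightarrow> x) (at_right 0)"
    by (auto simp: continuous_on_def matrix_exp_zero intro: tendsto_within_subset dest!: spec[of _ 0])
  have "((\<lambda>t. exp (- (of_real t * b)) * (4 * of_real pi * a) powr (- ?p) *
     (LINT y|lborel. exp (- ?z * of_real ((norm y)\<^sup>2)) * \<phi> (flow S t x + sqrt t *\<^sub>R y))) \<longlongrightarrow>
      exp (- (of_real 0 * b)) * (4 * of_real pi * a) powr (- ?p) *
      ((pi / ?z) powr (of_nat DIM(real^'d) / 2) * \<phi> x)) (at_right 0)"
    by (intro tendsto_mult gaussian_average_tendsto[where C = C] z \<phi> C q tendsto_exp tendsto_minus tendsto_of_real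
        tendsto_ident_at tendsto_const)
  also have "exp (- (of_real 0 * b)) * (4 * of_real pi * a) powr (- ?p) *
      ((pi / ?z) powr (of_nat DIM(real^'d) / 2) * \<phi> x) = \<phi> x"
  proof -
    \<comment> \<open>With this value of \<open>?z\<close> the Gaussian integral is exactly the
      reciprocal of the remaining normalization, so the limit has factor 1.\<close>
    have pi_z: "of_real pi / ?z = 4 * of_real pi * a" by simp
    have "4 * of_real pi * a \<noteq> 0" using a by auto
    then show ?thesis unfolding pi_z powr_minus by simp
  qed
  finally show ?thesis
  proof (rule Lim_transform_eventually)
    show "\<forall>\<^sub>F t in at_right 0. exp (- (of_real t * b)) * (4 * of_real pi * a) powr (- ?p) *
     (LINT y|lborel. exp (- ?z * of_real ((norm y)\<^sup>2)) * \<phi> (flow S t x + sqrt t *\<^sub>R y))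
      = (LINT \<xi>|lborel. scalar_kernel S a b x \<xi> t * \<phi> \<xi>)"
      using eventually_at_right_less[of 0]
      by eventually_elim
        (rule has_bochner_integral_integral_eq[symmetric, OF scalar_kernel_integral[OF _ a \<phi> C]])
  qed
qed

lemma test_function_continuous: "test_function \<phi> \<Longrightarrow> continuous_on UNIV \<phi>"
  unfolding test_function_def by (metis C_k.simps(1))

lemma test_function_bounded:
  assumes "test_function \<phi>"
  obtains C where "\<And>y. norm (\<phi> y) \<le> C"
proof -
  let ?K = "closure {x. \<phi> x \<noteq> 0}"
  have "compact (\<phi> ` ?K)"
    using assms continuous_on_subset[OF test_function_continuous[OF assms]]
    by (intro compact_continuous_image) (auto simp: test_function_def)
  then obtain C where C: "\<And>y. y \<in> ?K \<Longrightarrow> norm (\<phi> y) \<le> C"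
    by (meson bounded_iff compact_imp_bounded imageI)
  \<comment> \<open>The 0 covers points where \<open>\<phi>\<close> vanishes; \<open>C\<close> may
    be negative if the support is empty.\<close>
  have "norm (\<phi> y) \<le> max C 0" for y
    using C[of y] closure_subset[of "{x. \<phi> x \<noteq> 0}"] by (cases "\<phi> y = 0") (auto simp: le_max_iff_disj)
  then show thesis by (rule that)
qed

lemma spectral_sum_mult_mat:
  assumes "invertible Y"
  shows "(\<Sum>k\<in>UNIV. spectral_proj Y k (z k)) ** mat c = (\<Sum>k\<in>UNIV. spectral_proj Y k (z k * c))"
  unfolding diag_conj_eq_sum[symmetric] diag_conj_const[OF assms, symmetric] diag_conj_mult[OF assms] ..

lemma sum_spectral_proj_const:
  assumes "invertible Y"
  shows "(\<Sum>k\<in>UNIV. spectral_proj Y k c) = mat c"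
  unfolding diag_conj_eq_sum[symmetric] diag_conj_const[OF assms] ..

text \<open>Every scalar integral has the same limit \<open>\<phi> x\<close>, whatever
  \<open>a k\<close> and \<open>b k\<close> are, so the spectral projections recombine to the
  identity.\<close>

lemma spectral_sum_tendsto_delta:
  fixes Y :: "complex^'n^'n" and S :: "real^'d^'d"
  assumes Y: "invertible Y" and a: "\<And>k. Re (a k) > 0" and \<phi>: "test_function \<phi>"
    and H: "\<And>\<xi> t. t > 0 \<Longrightarrow> H \<xi> t = (\<Sum>k\<in>UNIV. spectral_proj Y k (scalar_kernel S (a k) (b k) x \<xi> t))"
  shows "((\<lambda>t. LINT \<xi>|lborel. H \<xi> t ** mat (\<phi> \<xi>)) \<longlongrightarrow> mat (\<phi> x)) (at_right 0)"
proof -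
  obtain C where C: "\<And>y. norm (\<phi> y) \<le> C"
    using test_function_bounded[OF \<phi>] by blast
  note cont = test_function_continuous[OF \<phi>]
  let ?I = "\<lambda>k t. LINT \<xi>|lborel. scalar_kernel S (a k) (b k) x \<xi> t * \<phi> \<xi>"
  have "((\<lambda>t. \<Sum>k\<in>UNIV. spectral_proj Y k (?I k t)) \<longlongrightarrow> (\<Sum>k\<in>UNIV. spectral_proj Y k (\<phi> x))) (at_right 0)"
    by (intro tendsto_sum bounded_linear.tendsto[OF bounded_linear_spectral_proj]
        scalar_kernel_integral_tendsto[where C = C] a cont C)
  then show ?thesis
    unfolding sum_spectral_proj_const[OF Y]
  proof (rule Lim_transform_eventually)
    show "\<forall>\<^sub>F t in at_right 0. (\<Sum>k\<in>UNIV. spectral_proj Y k (?I k t)) = (LINT \<xi>|lborel. H \<xi> t ** mat (\<phi> \<xi>))"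
      using eventually_at_right_less[of 0]
    proof eventually_elim
      case (elim t)
      have "has_bochner_integral lborel (\<lambda>\<xi>. H \<xi> t ** mat (\<phi> \<xi>)) (\<Sum>k\<in>UNIV. spectral_proj Y k (?I k t))"
        unfolding H[OF elim] spectral_sum_mult_mat[OF Y]
        by (intro has_bochner_integral_sum has_bochner_integral_bounded_linear[OF bounded_linear_spectral_proj]
            has_bochner_integral_integrable integrable.intros[OF scalar_kernel_integral[OF elim a cont C]])
      then show ?case by (rule has_bochner_integral_integral_eq[symmetric])
    qed
  qed
qed

theorem theorem3p1:
  fixes A B :: "complex^'n^'n" and S :: "real^'d^'d"
  assumes "CARD('d) \<ge> 2"
    and "simultaneously_diagonalizable A B"
    and "\<And>l. matrix_eigenvalue A l \<Longrightarrow> Re l > 0"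
    and "transpose S = - S"
  shows "heat_kernel (L_inf A B S)
    (\<lambda>x \<xi> t. matrix_powr ((4 * pi * t) *\<^sub>R A) (- (of_nat CARD('d) / 2)) **
       matrix_exp (- (t *\<^sub>R B) -
         (norm (matrix_exp (t *\<^sub>R S) *v x - \<xi>))\<^sup>2 *\<^sub>R matrix_inv ((4 * t) *\<^sub>R A)))"
    (is "heat_kernel _ ?H")
proof -
  obtain Y :: "complex^'n^'n" and a b where Y: "invertible Y"
    and A: "A = Y ** diag_matrix a ** matrix_inv Y" and B: "B = Y ** diag_matrix b ** matrix_inv Y"
    using assms(2) unfolding simultaneously_diagonalizable_def by blast
  have a: "Re (a k) > 0" for k
    using assms(3) matrix_eigenvalue_diag_conj[OF Y] unfolding A by blast
  have H: "?H x \<xi> t = (\<Sum>k\<in>UNIV. spectral_proj Y k (scalar_kernel S (a k) (b k) x \<xi> t))"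
    if "t > 0" for x \<xi> t
    using Y that a A B by (rule matrix_kernel_eq_sum)
  show ?thesis
    unfolding heat_kernel_def
  proof (intro conjI allI impI)
    show "C_klm 2 2 1 (\<lambda>(x, \<xi>, t). ?H x \<xi> t)"
      by (rule C_klm_spectral_sum[where a = a and b = b, OF a]) (simp only: prod.case H)
  next
    fix x \<xi> :: "real^'d" and t :: real and j assume t: "t > 0"
    show "((\<lambda>s. column j (?H x \<xi> s)) has_vector_derivative L_inf A B S (\<lambda>y. column j (?H y \<xi> t)) x) (at t)"
      unfolding H[OF t]
    \<comment> \<open>The spectral form is available only for positive time, an open set containing
      \<open>t\<close>.\<close>
    proof (rule has_vector_derivative_transform_within_open[where S = "{0<..}"])
      show "((\<lambda>t. column j (\<Sum>k\<in>UNIV. spectral_proj Y k (scalar_kernel S (a k) (b k) x \<xi> t))) has_vector_derivative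
        L_inf A B S (\<lambda>y. column j (\<Sum>k\<in>UNIV. spectral_proj Y k (scalar_kernel S (a k) (b k) y \<xi> t))) x) (at t)"
        using Y a assms(4) t A B by (rule spectral_sum_satisfies_pde)
    qed (use t H in auto)
  next
    fix x :: "real^'d" and \<phi> :: "real^'d \<Rightarrow> complex" assume "test_function \<phi>"
    then show "((\<lambda>t. LINT \<xi>|lborel. ?H x \<xi> t ** mat (\<phi> \<xi>)) \<longlongrightarrow> mat (\<phi> x)) (at_right 0)"
      using H by (rule spectral_sum_tendsto_delta[OF Y a])
  qed
qed

end
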